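(* Let $G$ be a finite non-solvable group and let $p$ be a fixed prime divisor of $|G|$. Then $G$ has a non-nilpotent maximal subgroup whose order is divisible by $p$. *)

theory Defs
  imports "HOL-Algebra.Algebra"
begin

definition commutator_subgroup :: "('a, 'b) monoid_scheme \<Rightarrow> 'a set \<Rightarrow> 'a set \<Rightarrow> 'a set" where
  "commutator_subgroup G H K =
     generate G (\<Union>h \<in> H. \<Union>k \<in> K. { h \<otimes>\<^bsub>G\<^esub> k \<otimes>\<^bsub>G\<^esub> inv\<^bsub>G\<^esub> h \<otimes>\<^bsub>G\<^esub> inv\<^bsub>G\<^esub> k })"

fun lower_central :: "('a, 'b) monoid_scheme \<Rightarrow> nat \<Rightarrow> 'a set" where
  "lower_central G 0 = carrier G"
| "lower_central G (Suc n) = commutator_subgroup G (lower_central G n) (carrier G)"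

definition nilpotent_group :: "('a, 'b) monoid_scheme \<Rightarrow> bool" where
  "nilpotent_group G \<longleftrightarrow> group G \<and> (\<exists>n. lower_central G n = {\<one>\<^bsub>G\<^esub>})"

definition maximal_subgroup :: "'a set \<Rightarrow> ('a, 'b) monoid_scheme \<Rightarrow> bool" where
  "maximal_subgroup H G \<longleftrightarrow> subgroup H G \<and> H \<noteq> carrier G \<and>
     (\<forall>K. subgroup K G \<and> H \<subseteq> K \<longrightarrow> K = H \<or> K = carrier G)"

end

theory Submission
  imports Defs
begin

text \<open>If every maximal subgroup of order divisible by p is nilpotent, then so is every proper subgroup
  of order divisible by p. A minimal non-solvable such G has no nontrivial solvable normal subgroup N:
  the quotient by N inherits the hypothesis for p, or for every prime if p divides the order of N.
  Hence normalizers of nontrivial p-subgroups are proper, so nilpotent. As normalizers grow in nilpotent groups,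
  distinct Sylow p-subgroups meet trivially, so fusion in a Sylow p-subgroup P is controlled by its
  normalizer M, and the transfer into the nontrivial abelian p-group P / [P, M] is nontrivial. Its kernel K has
  order prime to p. For a prime q other than p, a Sylow q-subgroup Q lies in K, and by the Frattini
  argument its normalizer contains a Sylow p-subgroup of G; as that normalizer is nilpotent, Q normalizes
  this Sylow p-subgroup. Comparing orders, P is normal in G, a contradiction.\<close>

section \<open>Nilpotent groups\<close>

text \<open>The obstacle is that nothing is assumed about subgroups of order prime to p. So the
  transfer kernel K, once its order is known to be prime to p, can have any structure, and its
  existence is not yet absurd. The detour through a Sylow q-subgroup Q of K leads back to the
  hypothesis: the normalizer of Q has order divisible by p, and it is proper because a nontrivial
  normal q-subgroup would have a nontrivial centre, which is solvable and normal in G. The order of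
  K is prime to p because K is proper: otherwise K would be nilpotent, hence a solvable normal
  subgroup, hence trivial. The subgroup [P, M] is the right one to divide by for two reasons. Modulo
  it every element of P equals its M-conjugates, which is what the transfer needs, and it is smaller
  than P because M is nilpotent. The prime changes in the induction because p may fail to divide the
  order of G/N. In that case p divides the order of N, so all proper subgroups of G/N pull back to
  subgroups covered by the hypothesis.\<close>

lemma (in group) commutator_in_commutator_subgroup:
  assumes "h \<in> H" "k \<in> K"
  shows "h \<otimes> k \<otimes> inv h \<otimes> inv k \<in> commutator_subgroup G H K"
  unfolding commutator_subgroup_def using assms by (intro generate.incl) blast

lemma (in group) commutator_subgroup_is_subgroup:
  assumes "H \<subseteq> carrier G" "K \<subseteq> carrier G"
  shows "subgroup (commutator_subgroup G H K) G"
  unfolding commutator_subgroup_def using assms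
  by (intro generate_is_subgroup) (auto simp: subset_iff)

lemma (in group) commutator_subgroup_least:
  assumes "subgroup L G" and "\<And>h k. h \<in> H \<Longrightarrow> k \<in> K \<Longrightarrow> h \<otimes> k \<otimes> inv h \<otimes> inv k \<in> L"
  shows "commutator_subgroup G H K \<subseteq> L"
  unfolding commutator_subgroup_def using assms by (intro generate_subgroup_incl) auto

lemma (in group) commutator_subgroup_mono:
  assumes "H \<subseteq> H'" "K \<subseteq> K'"
  shows "commutator_subgroup G H K \<subseteq> commutator_subgroup G H' K'"
  unfolding commutator_subgroup_def using assms by (intro mono_generate) blast

lemma (in group) commutator_subgroup_consistent:
  assumes "subgroup S G" "H \<subseteq> S" "K \<subseteq> S"
  shows "commutator_subgroup (G\<lparr>carrier := S\<rparr>) H K = commutator_subgroup G H K"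
proof -
  have eq: "(\<Union>h\<in>H. \<Union>k\<in>K. {h \<otimes> k \<otimes> inv\<^bsub>G\<lparr>carrier := S\<rparr>\<^esub> h \<otimes> inv\<^bsub>G\<lparr>carrier := S\<rparr>\<^esub> k})
      = (\<Union>h\<in>H. \<Union>k\<in>K. {h \<otimes> k \<otimes> inv h \<otimes> inv k})"
    using assms by (auto simp: subset_iff)
  have "(\<Union>h\<in>H. \<Union>k\<in>K. {h \<otimes> k \<otimes> inv h \<otimes> inv k}) \<subseteq> S"
    using assms subgroupE(3,4)[OF assms(1)] by (auto simp: subset_iff)
  then show ?thesis
    unfolding commutator_subgroup_def using eq generate_consistent[OF _ assms(1)] by simp
qed

lemma (in group_hom) commutator_subgroup_image:
  assumes "A \<subseteq> carrier G" "B \<subseteq> carrier G"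
  shows "commutator_subgroup H (h ` A) (h ` B) = h ` commutator_subgroup G A B"
proof -
  have "h ` (\<Union>a\<in>A. \<Union>b\<in>B. {a \<otimes> b \<otimes> inv a \<otimes> inv b})
      = (\<Union>a\<in>A. \<Union>b\<in>B. {h (a \<otimes> b \<otimes> inv a \<otimes> inv b)})"
    by blast
  also have "\<dots> = (\<Union>a\<in>h ` A. \<Union>b\<in>h ` B. {a \<otimes>\<^bsub>H\<^esub> b \<otimes>\<^bsub>H\<^esub> inv\<^bsub>H\<^esub> a \<otimes>\<^bsub>H\<^esub> inv\<^bsub>H\<^esub> b})"
    using assms by (simp add: subset_iff)
  finally show ?thesis
    unfolding commutator_subgroup_def using assms by (subst generate_img[symmetric]) (auto simp: subset_iff)
qed

lemma (in group) lower_central_is_subgroup: "subgroup (lower_central G n) G"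
proof (induction n)
  case (Suc n)
  then show ?case using commutator_subgroup_is_subgroup[OF subgroup.subset order_refl] by simp
qed (simp add: subgroup_self)

lemma (in group) lower_central_mono:
  assumes "subgroup H G"
  shows "lower_central (G\<lparr>carrier := H\<rparr>) n \<subseteq> lower_central G n"
proof (induction n)
  case 0
  then show ?case using subgroup.subset[OF assms] by simp
next
  case (Suc n)
  have "lower_central (G\<lparr>carrier := H\<rparr>) n \<subseteq> H"
    using subgroup.subset[OF group.lower_central_is_subgroup[OF subgroup_imp_group[OF assms]]] by simp
  then show ?case
    using commutator_subgroup_consistent[OF assms] commutator_subgroup_mono[OF Suc.IH]
      subgroup.subset[OF assms] by simp
qed

lemma (in group_hom) lower_central_image:
  assumes "h ` carrier G = carrier H"
  shows "lower_central H n = h ` lower_central G n"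
  using assms commutator_subgroup_image[OF subgroup.subset[OF G.lower_central_is_subgroup] order_refl]
  by (induction n) auto

lemma (in group) nilpotent_groupE:
  assumes "nilpotent_group G"
  obtains n where "lower_central G n = {\<one>}"
  using assms by (auto simp: nilpotent_group_def)

lemma (in group) nilpotent_subgroup:
  assumes "nilpotent_group G" "subgroup H G"
  shows "nilpotent_group (G\<lparr>carrier := H\<rparr>)"
proof -
  obtain n where n: "lower_central G n = {\<one>}"
    using assms(1) by (rule nilpotent_groupE)
  have "subgroup (lower_central (G\<lparr>carrier := H\<rparr>) n) (G\<lparr>carrier := H\<rparr>)"
    by (rule group.lower_central_is_subgroup[OF subgroup_imp_group[OF assms(2)]])
  then have "lower_central (G\<lparr>carrier := H\<rparr>) n = {\<one>}"
    using lower_central_mono[OF assms(2), of n] n subgroup.one_closed by fastforce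
  then show ?thesis
    using subgroup_imp_group[OF assms(2)] by (auto simp: nilpotent_group_def)
qed

lemma (in group_hom) nilpotent_image:
  assumes "h ` carrier G = carrier H" "nilpotent_group G"
  shows "nilpotent_group H"
proof -
  obtain n where "lower_central G n = {\<one>}"
    using assms(2) by (rule G.nilpotent_groupE)
  then have "lower_central H n = {\<one>\<^bsub>H\<^esub>}"
    using lower_central_image[OF assms(1)] by simp
  then show ?thesis by (auto simp: nilpotent_group_def)
qed

text \<open>The derived series lies termwise inside the lower central series, because commutator
  subgroups are monotone in both arguments.\<close>

lemma (in group) nilpotent_imp_solvable:
  assumes "nilpotent_group G"
  shows "solvable G"
proof -
  obtain n where n: "lower_central G n = {\<one>}"
    using assms by (rule nilpotent_groupE)
  have "(derived G ^^ k) (carrier G) \<subseteq> lower_central G k" for k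
  proof (induction k)
    case (Suc k)
    have "derived G ((derived G ^^ k) (carrier G))
        = commutator_subgroup G ((derived G ^^ k) (carrier G)) ((derived G ^^ k) (carrier G))"
      by (simp add: derived_def commutator_subgroup_def)
    then show ?case
      using commutator_subgroup_mono[OF Suc.IH] exp_of_derived_in_carrier[of "carrier G" k] by simp
  qed simp
  then have "(derived G ^^ n) (carrier G) = {\<one>}"
    using n subgroup.one_closed[OF exp_of_derived_is_subgroup[OF subgroup_self]] by blast
  then show ?thesis using solvable_iff_trivial_derived_seq by blast
qed

text \<open>Somewhere the lower central series drops into D. An element x of the term just above the
  drop has all its commutators in D, and x d x^-1 = [x, d] d.\<close>

lemma (in group) nilpotent_normalizes_larger:
  assumes "nilpotent_group G" "subgroup D G" "D \<noteq> carrier G"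
  obtains x where "x \<in> carrier G" "x \<notin> D" "\<And>d. d \<in> D \<Longrightarrow> x \<otimes> d \<otimes> inv x \<in> D"
proof -
  obtain n where n: "lower_central G n = {\<one>}"
    using assms(1) by (rule nilpotent_groupE)
  then have bot: "lower_central G n \<subseteq> D" and "\<not> lower_central G 0 \<subseteq> D"
    using assms(2,3) by (auto simp: subgroup.one_closed dest: subgroup.mem_carrier)
  then obtain i where i: "\<not> lower_central G i \<subseteq> D" "lower_central G (Suc i) \<subseteq> D"
    using dec_induct[of 0 n "\<lambda>i. \<not> lower_central G i \<subseteq> D"] by blast
  then obtain x where x: "x \<in> lower_central G i" "x \<notin> D" by blast
  then have xG: "x \<in> carrier G"
    using subgroup.mem_carrier[OF lower_central_is_subgroup] by blast
  have "x \<otimes> d \<otimes> inv x \<in> D" if d: "d \<in> D" for d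
  proof -
    have dG: "d \<in> carrier G" using d assms(2) by (rule subgroup.mem_carrier[rotated])
    have "x \<otimes> d \<otimes> inv x \<otimes> inv d \<in> D"
      using commutator_in_commutator_subgroup[OF x(1) dG] i(2) by auto
    then have "x \<otimes> d \<otimes> inv x \<otimes> inv d \<otimes> d \<in> D"
      using subgroup.m_closed[OF assms(2)] d by blast
    then show ?thesis using xG dG by (simp add: m_assoc)
  qed
  then show thesis using that xG x(2) by blast
qed

text \<open>If [P, G] were all of P, then P would survive in every term of the lower central series.
  Strictness is what later makes the target of the transfer nontrivial.\<close>

lemma (in group) commutator_subgroup_nilpotent_psubset:
  assumes "nilpotent_group G" "subgroup P G" "P \<noteq> {\<one>}"
    and "\<And>g x. g \<in> carrier G \<Longrightarrow> x \<in> P \<Longrightarrow> g \<otimes> x \<otimes> inv g \<in> P"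
  shows "commutator_subgroup G P (carrier G) \<subset> P"
proof -
  have sub: "commutator_subgroup G P (carrier G) \<subseteq> P"
  proof (rule commutator_subgroup_least[OF assms(2)])
    fix x g assume x: "x \<in> P" and g: "g \<in> carrier G"
    have xG: "x \<in> carrier G" using x assms(2) by (rule subgroup.mem_carrier[rotated])
    have "x \<otimes> (g \<otimes> inv x \<otimes> inv g) \<in> P"
      using x g assms(4) subgroup.m_inv_closed[OF assms(2)] subgroup.m_closed[OF assms(2)] by blast
    then show "x \<otimes> g \<otimes> inv x \<otimes> inv g \<in> P" using xG g by (simp add: m_assoc)
  qed
  moreover have "commutator_subgroup G P (carrier G) \<noteq> P"
  proof
    assume eq: "commutator_subgroup G P (carrier G) = P"
    have "P \<subseteq> lower_central G n" for n
    proof (induction n)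
      case 0
      then show ?case using subgroup.subset[OF assms(2)] by simp
    next
      case (Suc n)
      then show ?case using commutator_subgroup_mono[OF Suc order_refl, of "carrier G"] eq by simp
    qed
    moreover obtain n where "lower_central G n = {\<one>}"
      using assms(1) by (rule nilpotent_groupE)
    ultimately show False using assms(3) subgroup.one_closed[OF assms(2)] by blast
  qed
  ultimately show ?thesis by blast
qed

section \<open>Normalizers and Sylow subgroups\<close>

lemma (in group) l_coset_r_coset_inv_eq_image: "g <# H #> inv g = (\<lambda>h. g \<otimes> h \<otimes> inv g) ` H"
  by (auto simp: l_coset_def r_coset_def)

lemma (in group) mem_normalizer_iff:
  assumes "H \<subseteq> carrier G"
  shows "g \<in> normalizer G H \<longleftrightarrow> g \<in> carrier G \<and> (\<lambda>h. g \<otimes> h \<otimes> inv g) ` H = H"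
  using assms by (simp add: normalizer_def stabilizer_def l_coset_r_coset_inv_eq_image)

lemma (in group) conjugation_inj_on:
  assumes "g \<in> carrier G" "H \<subseteq> carrier G"
  shows "inj_on (\<lambda>h. g \<otimes> h \<otimes> inv g) H"
  using assms by (auto intro!: inj_onI simp: subset_iff)

text \<open>Finiteness upgrades the inclusion to equality: conjugation is injective, so it maps a
  finite set that it preserves onto itself.\<close>

lemma (in group) normalizerI:
  assumes "finite H" "H \<subseteq> carrier G" "g \<in> carrier G" "\<And>h. h \<in> H \<Longrightarrow> g \<otimes> h \<otimes> inv g \<in> H"
  shows "g \<in> normalizer G H"
  using assms conjugation_inj_on[of g H]
  by (simp add: mem_normalizer_iff endo_inj_surj image_subset_iff)

lemma (in group) normalizer_conj_closed:
  assumes "H \<subseteq> carrier G" "g \<in> normalizer G H" "h \<in> H"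
  shows "g \<otimes> h \<otimes> inv g \<in> H"
  using assms by (auto simp: mem_normalizer_iff)

lemma (in group) subgroup_subset_normalizer:
  assumes "subgroup H G"
  shows "H \<subseteq> normalizer G H"
proof
  fix g assume "g \<in> H"
  with assms show "g \<in> normalizer G H"
    using coset_join2[of "inv g" H] coset_join3[of g H] subgroup.mem_carrier[OF assms]
      subgroup.m_inv_closed[OF assms] subgroup.subset[OF assms]
    by (simp add: mem_normalizer_iff flip: l_coset_r_coset_inv_eq_image)
qed

lemma (in group) normal_iff_normalizer_eq_carrier:
  assumes "subgroup H G"
  shows "H \<lhd> G \<longleftrightarrow> normalizer G H = carrier G"
proof
  assume H: "H \<lhd> G"
  have "g \<in> normalizer G H" if "g \<in> carrier G" for g
    using that H subgroup.subset[OF assms] lcos_mult_one[of H]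
    by (simp add: mem_normalizer_iff flip: l_coset_r_coset_inv_eq_image)
      (metis coset_mult_assoc coset_mult_one inv_closed normal.coset_eq r_inv)
  then show "normalizer G H = carrier G"
    using mem_normalizer_iff[OF subgroup.subset[OF assms]] by blast
next
  assume "normalizer G H = carrier G"
  then show "H \<lhd> G"
    using normalizer_conj_closed[OF subgroup.subset[OF assms]] assms by (intro normal_invI) auto
qed

lemma (in group) conjugate_subgroup:
  assumes "subgroup H G" "g \<in> carrier G"
  shows "subgroup ((\<lambda>h. g \<otimes> h \<otimes> inv g) ` H) G"
  using subgroup_conjugation_is_surj2[of g H] assms
  by (simp flip: l_coset_r_coset_inv_eq_image)

lemma (in group) card_conjugate:
  assumes "H \<subseteq> carrier G" "g \<in> carrier G"
  shows "card ((\<lambda>h. g \<otimes> h \<otimes> inv g) ` H) = card H"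
  using assms by (intro card_image conjugation_inj_on)

lemma (in group) subgroup_card_dvd_order:
  assumes "subgroup H G"
  shows "card H dvd order G"
  using lagrange[OF assms] dvd_triv_right by metis

lemma (in group) subgroup_card_dvd:
  assumes "subgroup H G" "subgroup K G" "H \<subseteq> K"
  shows "card H dvd card K"
  using group.subgroup_card_dvd_order[OF subgroup_imp_group[OF assms(2)], of H]
    subgroup_incl[OF assms] by (simp add: order_def)

section \<open>Actions of groups of prime power order on finite sets\<close>

lemma (in group) group_actionI:
  assumes closed: "\<And>g e. g \<in> carrier G \<Longrightarrow> e \<in> E \<Longrightarrow> \<phi> g e \<in> E"
    and one: "\<And>e. e \<in> E \<Longrightarrow> \<phi> \<one> e = e"
    and mult: "\<And>g h e. g \<in> carrier G \<Longrightarrow> h \<in> carrier G \<Longrightarrow> e \<in> E \<Longrightarrow> \<phi> (g \<otimes> h) e = \<phi> g (\<phi> h e)"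
  shows "group_action G E (\<lambda>g. restrict (\<phi> g) E)"
proof -
  \<comment> \<open>Elements of \<open>Bij E\<close> are extensional functions, hence the
    restriction; the inverse of the action of g is the action of \<open>inv g\<close>.\<close>
  have bij: "restrict (\<phi> g) E \<in> Bij E" if g: "g \<in> carrier G" for g
  proof -
    have "bij_betw (\<phi> g) E E"
      using g closed one mult[of g "inv g"] mult[of "inv g" g]
      by (intro bij_betw_byWitness[where f' = "\<phi> (inv g)"]) auto
    then show ?thesis by (simp add: Bij_def cong: bij_betw_cong)
  qed
  then have "(\<lambda>g. restrict (\<phi> g) E) \<in> hom G (BijGroup E)"
    using closed mult by (auto simp: hom_def BijGroup_def compose_def fun_eq_iff)
  then show ?thesis
    by (simp add: group_action_def group_hom_def group_hom_axioms_def group_BijGroup)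
qed

text \<open>Orbit sizes divide p^k. If none were 1, p would divide each of them and therefore their
  sum, the size of E.\<close>

lemma (in group_action) prime_power_fixed_point:
  assumes "Factorial_Ring.prime p" "order G = p ^ k" "finite E" "\<not> p dvd card E"
  obtains e where "e \<in> E" "\<And>g. g \<in> carrier G \<Longrightarrow> \<phi> g e = e"
proof -
  have "\<exists>e\<in>E. card (orbit G \<phi> e) = 1"
  proof (rule ccontr)
    assume none: "\<not> (\<exists>e\<in>E. card (orbit G \<phi> e) = 1)"
    have "p dvd card B" if B: "B \<in> orbits G E \<phi>" for B
    proof -
      obtain e where e: "e \<in> E" "B = orbit G \<phi> e"
        using B by (auto simp: orbits_def)
      then have "card B dvd p ^ k"
        using orbit_stabilizer_theorem[of e] assms(2) dvd_triv_left by metis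
      then obtain i where i: "card B = p ^ i"
        using divides_primepow_nat[OF assms(1)] by blast
      have "card B \<noteq> 1" using none e by blast
      with i show ?thesis by (cases i) auto
    qed
    then have "p dvd (\<Sum>B\<in>orbits G E \<phi>. card B)" by (rule dvd_sum)
    also have "(\<Sum>B\<in>orbits G E \<phi>. card B) = card E"
      using disjoint_sum[OF assms(3), of "\<lambda>_. 1::nat"] by simp
    finally show False using assms(4) by blast
  qed
  then obtain e where e: "e \<in> E" "card (orbit G \<phi> e) = 1" by blast
  obtain e' where e': "orbit G \<phi> e = {e'}"
    using e(2) by (auto simp: card_1_singleton_iff)
  have "\<phi> g e = e" if "g \<in> carrier G" for g
  proof -
    have "\<phi> g e \<in> orbit G \<phi> e" using that by (auto simp: orbit_def)
    moreover have "e \<in> orbit G \<phi> e" using orbit_refl[OF e(1)] .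
    ultimately show ?thesis using e' by simp
  qed
  then show thesis using that e(1) by blast
qed

text \<open>R acts on the right cosets of S, whose number is prime to p, so some coset S g is fixed.
  From S g r = S g it follows that g r g^-1 lies in S.\<close>

lemma (in group) sylow_conjugate:
  assumes p: "Factorial_Ring.prime p" and fin: "finite (carrier G)"
    and S: "subgroup S G" "\<not> p dvd card (rcosets S)"
    and R: "subgroup R G" "card R = p ^ k"
  obtains g where "g \<in> carrier G" "\<And>r. r \<in> R \<Longrightarrow> g \<otimes> r \<otimes> inv g \<in> S"
proof -
  interpret R: group "G\<lparr>carrier := R\<rparr>" by (rule subgroup_imp_group[OF R(1)])
  have SG: "S \<subseteq> carrier G" and RG: "R \<subseteq> carrier G"
    using S(1) R(1) by (auto simp: subgroup.subset)
  have RC: "C \<subseteq> carrier G" if "C \<in> rcosets S" for C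
    using that rcosets_subset_PowG[OF S(1)] by blast
  \<comment> \<open>The inverse turns right multiplication into a left action.\<close>
  have act: "group_action (G\<lparr>carrier := R\<rparr>) (rcosets S) (\<lambda>r. restrict (\<lambda>C. C #> inv r) (rcosets S))"
  proof (rule R.group_actionI)
    fix r C assume "r \<in> carrier (G\<lparr>carrier := R\<rparr>)" "C \<in> rcosets S"
    then show "C #> inv r \<in> rcosets S"
      using SG RG by (auto simp: RCOSETS_def coset_mult_assoc subset_iff)
  next
    fix C assume "C \<in> rcosets S"
    then show "C #> inv \<one>\<^bsub>G\<lparr>carrier := R\<rparr>\<^esub> = C" using RC by simp
  next
    fix r s C assume "r \<in> carrier (G\<lparr>carrier := R\<rparr>)" "s \<in> carrier (G\<lparr>carrier := R\<rparr>)" "C \<in> rcosets S"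
    then show "C #> inv (r \<otimes>\<^bsub>G\<lparr>carrier := R\<rparr>\<^esub> s) = (C #> inv s) #> inv r"
      using RC RG by (simp add: coset_mult_assoc inv_mult_group subset_iff)
  qed
  have fin': "finite (rcosets S)"
    using fin by (auto simp: RCOSETS_def)
  obtain C where C: "C \<in> rcosets S"
    and fixed: "\<And>r. r \<in> R \<Longrightarrow> restrict (\<lambda>C. C #> inv r) (rcosets S) C = C"
    by (rule group_action.prime_power_fixed_point[OF act p _ fin' S(2), of k]) (use R(2) in \<open>auto simp: order_def\<close>)
  obtain g where g: "g \<in> carrier G" "C = S #> g" using C by (auto simp: RCOSETS_def)
  have "g \<otimes> r \<otimes> inv g \<in> S" if r: "r \<in> R" for r
  proof -
    have rG: "r \<in> carrier G" using r RG by blast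
    have "S #> g #> inv (inv r) = S #> g"
      using fixed[of "inv r"] subgroup.m_inv_closed[OF R(1) r] C g(2) by simp
    then have "S #> (g \<otimes> r) = S #> g" using SG g rG by (simp add: coset_mult_assoc)
    then have "g \<otimes> r \<in> S #> g" using rcos_self[of "g \<otimes> r" S] g rG S(1) by simp
    then show ?thesis using subgroup.rcos_module_imp[OF S(1) group_axioms g(1)] by simp
  qed
  then show thesis using that g(1) by blast
qed

text \<open>Z is the centre of Q. It is abelian, so its solvability is immediate, and it is normal
  in G because conjugation by G preserves Q and hence its centre.\<close>

lemma (in group) normal_prime_power_subgroup_center:
  assumes p: "Factorial_Ring.prime p" and Q: "Q \<lhd> G" "card Q = p ^ k" "k > 0"
  obtains Z where "Z \<lhd> G" "Z \<noteq> {\<one>}" "solvable (G\<lparr>carrier := Z\<rparr>)"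
proof -
  define Z where "Z = {z \<in> Q. \<forall>x\<in>Q. x \<otimes> z = z \<otimes> x}"
  have subQ: "subgroup Q G" and conjQ: "\<And>g x. g \<in> carrier G \<Longrightarrow> x \<in> Q \<Longrightarrow> g \<otimes> x \<otimes> inv g \<in> Q"
    using Q(1) normal_invE by auto
  interpret Q: subgroup Q G by (rule subQ)
  interpret QG: group "G\<lparr>carrier := Q\<rparr>" by (rule subgroup_imp_group[OF subQ])
  have finQ: "finite Q" using Q(2) p by (intro card_ge_0_finite) (simp add: prime_gt_0_nat)
  have Z_iff: "z \<in> Z \<longleftrightarrow> z \<in> Q \<and> (\<forall>x\<in>Q. x \<otimes> z = z \<otimes> x)" for z
    by (simp only: Z_def mem_Collect_eq)
  then have ZQ: "Z \<subseteq> Q" by blast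
  have comm: "x \<otimes> z = z \<otimes> x" if "x \<in> Q" "z \<in> Z" for x z
    using that(2)[unfolded Z_iff] that(1) by (elim conjE) (erule bspec)
  have ZI: "z \<in> Z" if "z \<in> Q" "\<And>x. x \<in> Q \<Longrightarrow> x \<otimes> z = z \<otimes> x" for z
    using that unfolding Z_iff by (intro conjI ballI)
  have ZG: "z \<in> carrier G" if "z \<in> Z" for z
    using subsetD[OF ZQ that] by (rule Q.mem_carrier)
  have subZ: "subgroup Z G"
  proof (rule subgroupI)
    show "Z \<subseteq> carrier G" using ZG by (rule subsetI)
    have "\<one> \<in> Z" by (rule ZI) simp_all
    then show "Z \<noteq> {}" by blast
  next
    fix a assume a: "a \<in> Z"
    show "inv a \<in> Z"
    proof (rule ZI)
      show "inv a \<in> Q" using subsetD[OF ZQ a] by (rule Q.m_inv_closed)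
      fix x assume x: "x \<in> Q"
      then have "x \<otimes> a = a \<otimes> x" "a \<in> carrier G" "x \<in> carrier G" using a comm ZG by auto
      then show "x \<otimes> inv a = inv a \<otimes> x"
        by (metis inv_closed inv_solve_left inv_solve_right m_assoc m_closed)
    qed
  next
    fix a b assume ab: "a \<in> Z" "b \<in> Z"
    show "a \<otimes> b \<in> Z"
    proof (rule ZI)
      show "a \<otimes> b \<in> Q" using ab[THEN subsetD[OF ZQ]] by (rule Q.m_closed)
      fix x assume x: "x \<in> Q"
      then have "x \<otimes> a = a \<otimes> x" "x \<otimes> b = b \<otimes> x" "a \<in> carrier G" "b \<in> carrier G" "x \<in> carrier G"
        using ab comm ZG by auto
      then show "x \<otimes> (a \<otimes> b) = a \<otimes> b \<otimes> x" by (metis m_assoc)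
    qed
  qed
  have "Z \<lhd> G"
  proof (rule normal_invI[OF subZ])
    fix g z assume g: "g \<in> carrier G" and z: "z \<in> Z"
    have zG: "z \<in> carrier G" using z by (rule ZG)
    have cancel: "g \<otimes> (inv g \<otimes> y) = y" if "y \<in> carrier G" for y
      using g that by (simp flip: m_assoc)
    show "g \<otimes> z \<otimes> inv g \<in> Z"
    proof (rule ZI)
      show "g \<otimes> z \<otimes> inv g \<in> Q" using g subsetD[OF ZQ z] by (rule conjQ)
      fix x assume x: "x \<in> Q"
      have xG: "x \<in> carrier G" using x by simp
      \<comment> \<open>x commutes with g z g^-1 exactly when g^-1 x g commutes with z, and the
        latter holds since g^-1 x g is again in Q.\<close>
      have "inv g \<otimes> x \<otimes> g \<in> Q" using conjQ[of "inv g" x] g x by simp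
      then have swap: "(inv g \<otimes> x \<otimes> g) \<otimes> z = z \<otimes> (inv g \<otimes> x \<otimes> g)" using z by (rule comm)
      have "x \<otimes> (g \<otimes> z \<otimes> inv g) = g \<otimes> ((inv g \<otimes> x \<otimes> g) \<otimes> z) \<otimes> inv g"
        using g xG zG by (simp add: m_assoc cancel)
      also have "\<dots> = g \<otimes> z \<otimes> inv g \<otimes> x"
        unfolding swap using g xG zG by (simp add: m_assoc)
      finally show "x \<otimes> (g \<otimes> z \<otimes> inv g) = g \<otimes> z \<otimes> inv g \<otimes> x" .
    qed
  qed
  moreover have "Z \<noteq> {\<one>}"
  proof -
    \<comment> \<open>With the identity removed, the set has p^k - 1 elements, a number prime to p.
      A point fixed under conjugation is then a central element other than the identity.\<close>
    have act: "group_action (G\<lparr>carrier := Q\<rparr>) (Q - {\<one>}) (\<lambda>g. restrict (\<lambda>x. g \<otimes> x \<otimes> inv g) (Q - {\<one>}))"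
    proof (rule QG.group_actionI)
      fix g e assume *: "g \<in> carrier (G\<lparr>carrier := Q\<rparr>)" "e \<in> Q - {\<one>}"
      have "e = \<one>" if "g \<otimes> e \<otimes> inv g = \<one>"
        using that * conjugation_inj_on[of g "carrier G"] by (auto dest: inj_onD[where y = \<one>])
      then show "g \<otimes> e \<otimes> inv g \<in> Q - {\<one>}" using * by auto
    next
      fix g h e assume "g \<in> carrier (G\<lparr>carrier := Q\<rparr>)" "h \<in> carrier (G\<lparr>carrier := Q\<rparr>)" "e \<in> Q - {\<one>}"
      then show "g \<otimes>\<^bsub>G\<lparr>carrier := Q\<rparr>\<^esub> h \<otimes> e \<otimes> inv (g \<otimes>\<^bsub>G\<lparr>carrier := Q\<rparr>\<^esub> h) = g \<otimes> (h \<otimes> e \<otimes> inv h) \<otimes> inv g"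
        by (simp add: inv_mult_group m_assoc)
    qed auto
    have ndvd: "\<not> p dvd card (Q - {\<one>})"
    proof
      assume "p dvd card (Q - {\<one>})"
      moreover have "p dvd card Q" using Q(2,3) by simp
      moreover have "card Q = card (Q - {\<one>}) + 1" using card.remove[OF finQ Q.one_closed] by simp
      ultimately have "p dvd 1" by (metis dvd_add_right_iff)
      then show False using p by simp
    qed
    obtain e where e: "e \<in> Q - {\<one>}"
      and fixed: "\<And>g. g \<in> Q \<Longrightarrow> restrict (\<lambda>x. g \<otimes> x \<otimes> inv g) (Q - {\<one>}) e = e"
      by (rule group_action.prime_power_fixed_point[OF act p _ _ ndvd, of k])
        (use Q(2) finQ in \<open>auto simp: order_def\<close>)
    have "e \<in> Z"
    proof (rule ZI)
      show "e \<in> Q" using e by blast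
      fix x assume x: "x \<in> Q"
      then show "x \<otimes> e = e \<otimes> x"
        using fixed[OF x] e inv_solve_right'[of e "x \<otimes> e" x] by simp
    qed
    then show ?thesis using e by blast
  qed
  moreover have "solvable (G\<lparr>carrier := Z\<rparr>)"
  proof -
    have "comm_group (G\<lparr>carrier := Z\<rparr>)"
      using subgroup_imp_group[OF subZ] by (rule group.group_comm_groupI) (use comm ZQ in auto)
    then show ?thesis
      using comm_group.derived_eq_singleton[of "G\<lparr>carrier := Z\<rparr>" Z]
        group.solvable_iff_trivial_derived_seq[OF subgroup_imp_group[OF subZ]]
      by (auto intro: exI[of _ "1::nat"])
  qed
  ultimately show thesis using that by blast
qed

section \<open>Sylow subgroups and their conjugacy\<close>

definition sylow_subgroup :: "('a, 'b) monoid_scheme \<Rightarrow> nat \<Rightarrow> 'a set \<Rightarrow> bool" where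
  "sylow_subgroup G p S \<longleftrightarrow> subgroup S G \<and> card S = p ^ multiplicity p (order G)"

lemma (in group) sylow_subgroup_exists:
  assumes "Factorial_Ring.prime p" "finite (carrier G)"
  obtains S where "sylow_subgroup G p S"
proof -
  obtain m where "order G = p ^ multiplicity p (order G) * m"
    using multiplicity_dvd[of p "order G"] by (elim dvdE)
  then show thesis
    using that sylow_thm[OF assms(1) group_axioms _ assms(2)] by (auto simp: sylow_subgroup_def)
qed

lemma (in group) sylow_subgroup_index:
  assumes "Factorial_Ring.prime p" "finite (carrier G)" "sylow_subgroup G p S"
  shows "\<not> p dvd card (rcosets S)"
proof
  assume "p dvd card (rcosets S)"
  then have "p * p ^ multiplicity p (order G) dvd card (rcosets S) * card S"
    using assms(3) by (simp add: sylow_subgroup_def)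
  also have "card (rcosets S) * card S = order G"
    using assms(3) by (intro lagrange) (simp add: sylow_subgroup_def)
  finally have "p ^ Suc (multiplicity p (order G)) dvd order G" by simp
  moreover have "order G \<noteq> 0" using assms(2) order_gt_0_iff_finite by simp
  ultimately show False
    using multiplicity_geI[of "order G" p "Suc (multiplicity p (order G))"]
      prime_gt_1_nat[OF assms(1)] by simp
qed

text \<open>The exponent of p in the order of N is squeezed: the order of N divides that of G and is
  divisible by that of S.\<close>

lemma (in group) sylow_subgroup_within:
  assumes "Factorial_Ring.prime p" "finite (carrier G)" "sylow_subgroup G p S" "subgroup N G" "S \<subseteq> N"
  shows "sylow_subgroup (G\<lparr>carrier := N\<rparr>) p S"
proof -
  have S: "subgroup S G" "card S = p ^ multiplicity p (order G)"
    using assms(3) by (auto simp: sylow_subgroup_def)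
  have "card N \<noteq> 0" "order G \<noteq> 0"
    using assms(2,4) order_gt_0_iff_finite subgroup.finite_imp_card_positive[OF assms(4)] by auto
  moreover have "card N dvd order G" using assms(4) by (rule subgroup_card_dvd_order)
  moreover have "p ^ multiplicity p (order G) dvd card N"
    using subgroup_card_dvd[OF S(1) assms(4,5)] S(2) by simp
  ultimately have "multiplicity p (card N) = multiplicity p (order G)"
    using prime_gt_1_nat[OF assms(1)] dvd_imp_multiplicity_le[of "card N" "order G" p]
      multiplicity_geI[of "card N" p "multiplicity p (order G)"] by (intro antisym) simp_all
  then show ?thesis
    using S subgroup_incl[OF S(1) assms(4,5)] by (simp add: sylow_subgroup_def order_def)
qed

lemma (in group) conjugate_sylow_subgroup:
  assumes "sylow_subgroup G p S" "g \<in> carrier G"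
  shows "sylow_subgroup G p ((\<lambda>h. g \<otimes> h \<otimes> inv g) ` S)"
  using assms conjugate_subgroup card_conjugate[OF subgroup.subset]
  by (simp add: sylow_subgroup_def)

lemma (in group) subgroup_subset_sylow_conjugate:
  assumes "Factorial_Ring.prime p" "finite (carrier G)" "sylow_subgroup G p S"
    and "subgroup R G" "card R = p ^ k"
  obtains g where "g \<in> carrier G" "(\<lambda>h. g \<otimes> h \<otimes> inv g) ` R \<subseteq> S"
proof -
  have "subgroup S G" using assms(3) by (simp add: sylow_subgroup_def)
  then show thesis
    using sylow_conjugate[OF assms(1,2) _ sylow_subgroup_index[OF assms(1-3)] assms(4,5)] that
    by (metis image_subsetI)
qed

lemma (in group) conjugate_inverse_image:
  assumes "g \<in> carrier G" "H \<subseteq> carrier G"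
  shows "(\<lambda>h. inv g \<otimes> h \<otimes> inv (inv g)) ` (\<lambda>h. g \<otimes> h \<otimes> inv g) ` H = H"
proof -
  have "inv g \<otimes> (g \<otimes> h \<otimes> inv g) \<otimes> inv (inv g) = h" if "h \<in> H" for h
  proof -
    have "h \<in> carrier G" using that assms(2) by blast
    then show ?thesis using assms(1) by (simp add: m_assoc) (simp flip: m_assoc)
  qed
  then show ?thesis by (simp add: image_image)
qed

lemma (in group) subset_sylow_subgroup:
  assumes "Factorial_Ring.prime p" "finite (carrier G)" "subgroup R G" "card R = p ^ k"
  obtains S where "sylow_subgroup G p S" "R \<subseteq> S"
proof -
  obtain S where S: "sylow_subgroup G p S"
    using assms(1,2) by (rule sylow_subgroup_exists)
  obtain g where g: "g \<in> carrier G" "(\<lambda>h. g \<otimes> h \<otimes> inv g) ` R \<subseteq> S"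
    using assms(1,2) S assms(3,4) by (rule subgroup_subset_sylow_conjugate)
  have "R \<subseteq> (\<lambda>h. inv g \<otimes> h \<otimes> inv (inv g)) ` S"
    using image_mono[OF g(2)] conjugate_inverse_image[OF g(1) subgroup.subset[OF assms(3)]] by metis
  then show thesis
    using that conjugate_sylow_subgroup[OF S inv_closed[OF g(1)]] by blast
qed

lemma (in group) sylow_subgroups_conjugate:
  assumes "Factorial_Ring.prime p" "finite (carrier G)" "sylow_subgroup G p R" "sylow_subgroup G p S"
  obtains g where "g \<in> carrier G" "(\<lambda>h. g \<otimes> h \<otimes> inv g) ` R = S"
proof -
  have R: "subgroup R G" "card R = p ^ multiplicity p (order G)" "card S = card R"
    and S: "subgroup S G"
    using assms(3,4) by (auto simp: sylow_subgroup_def)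
  obtain g where g: "g \<in> carrier G" "(\<lambda>h. g \<otimes> h \<otimes> inv g) ` R \<subseteq> S"
    using assms(1,2,4) R(1,2) by (rule subgroup_subset_sylow_conjugate)
  have "(\<lambda>h. g \<otimes> h \<otimes> inv g) ` R = S"
    using g R card_conjugate[of R g] finite_subset[OF subgroup.subset[OF S] assms(2)] subgroup.subset[OF R(1)]
    by (intro card_subset_eq) auto
  then show thesis using that g(1) by blast
qed

lemma (in group) normal_sylow_subgroup_contains:
  assumes "Factorial_Ring.prime p" "finite (carrier G)" "sylow_subgroup G p S" "S \<lhd> G"
    and "subgroup R G" "card R = p ^ k"
  shows "R \<subseteq> S"
proof -
  obtain g where g: "g \<in> carrier G" "(\<lambda>h. g \<otimes> h \<otimes> inv g) ` R \<subseteq> S"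
    using assms(1-3,5,6) by (rule subgroup_subset_sylow_conjugate)
  have "R \<subseteq> (\<lambda>h. inv g \<otimes> h \<otimes> inv (inv g)) ` S"
    using image_mono[OF g(2)] conjugate_inverse_image[OF g(1) subgroup.subset[OF assms(5)]] by metis
  also have "\<dots> \<subseteq> S"
    using normal_invE(2)[OF assms(4) inv_closed[OF g(1)]] by (rule image_subsetI)
  finally show ?thesis .
qed

text \<open>If the normalizer N of S were proper, some x outside N would normalize N. Then S and x S
  x^-1 are Sylow subgroups of N, hence conjugate by some g in N. So g x normalizes S, which forces x
  into N.\<close>

lemma (in group) nilpotent_sylow_normal:
  assumes "nilpotent_group G" "Factorial_Ring.prime p" "finite (carrier G)" "sylow_subgroup G p S"
  shows "S \<lhd> G"
proof (rule ccontr)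
  assume notnormal: "\<not> S \<lhd> G"
  have S: "subgroup S G" "S \<subseteq> carrier G"
    using assms(4) subgroup.subset by (auto simp: sylow_subgroup_def)
  define N where "N = normalizer G S"
  have N: "subgroup N G" "N \<noteq> carrier G" "S \<subseteq> N"
    using notnormal normal_iff_normalizer_eq_carrier[OF S(1)] normalizer_imp_subgroup[OF S(2)]
      subgroup_subset_normalizer[OF S(1)] by (auto simp: N_def)
  interpret N: group "G\<lparr>carrier := N\<rparr>" by (rule subgroup_imp_group[OF N(1)])
  obtain x where x: "x \<in> carrier G" "x \<notin> N" "\<And>d. d \<in> N \<Longrightarrow> x \<otimes> d \<otimes> inv x \<in> N"
    using assms(1) N(1,2) by (rule nilpotent_normalizes_larger) blast
  define R where "R = (\<lambda>h. x \<otimes> h \<otimes> inv x) ` S"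
  have R: "sylow_subgroup G p R"
    unfolding R_def by (rule conjugate_sylow_subgroup[OF assms(4) x(1)])
  have "R \<subseteq> N" using x(3) N(3) by (auto simp: R_def)
  then have "sylow_subgroup (G\<lparr>carrier := N\<rparr>) p R"
    using R N(1) assms(2,3) by (intro sylow_subgroup_within)
  moreover have "sylow_subgroup (G\<lparr>carrier := N\<rparr>) p S"
    using N assms by (intro sylow_subgroup_within)
  moreover have "finite (carrier (G\<lparr>carrier := N\<rparr>))"
    using finite_subset[OF subgroup.subset[OF N(1)] assms(3)] by simp
  ultimately obtain g where g: "g \<in> N" "(\<lambda>h. g \<otimes> h \<otimes> inv\<^bsub>G\<lparr>carrier := N\<rparr>\<^esub> g) ` R = S"
    using N.sylow_subgroups_conjugate[of p R S] assms(2) by auto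
  have gG: "g \<in> carrier G" using g(1) subgroup.mem_carrier[OF N(1)] by blast
  have "g \<otimes> x \<in> normalizer G S"
  proof (rule normalizerI)
    show "finite S" using S(2) assms(3) by (rule finite_subset)
    show "g \<otimes> x \<in> carrier G" using gG x(1) by simp
    fix h assume h: "h \<in> S"
    have "g \<otimes> (x \<otimes> h \<otimes> inv x) \<otimes> inv g \<in> S"
      using g h N(1) by (auto simp: R_def)
    then show "g \<otimes> x \<otimes> h \<otimes> inv (g \<otimes> x) \<in> S"
      using gG x(1) h S(2) by (simp add: m_assoc inv_mult_group subset_iff)
  qed (rule S(2))
  then have "inv g \<otimes> (g \<otimes> x) \<in> N"
    using subgroup.m_closed[OF N(1)] subgroup.m_inv_closed[OF N(1) g(1)] by (simp add: N_def)
  then show False using x(1,2) gG by (simp flip: m_assoc)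
qed

text \<open>The first isomorphism theorem as a count. It speaks of the image because it is also
  applied to the transfer, for which surjectivity is not established.\<close>

lemma (in group_hom) card_image_kernel:
  "card (h ` carrier G) * card (kernel G H h) = order G"
proof -
  have "the_elem (h ` (kernel G H h #> g)) = h g" if g: "g \<in> carrier G" for g
  proof -
    have "h y = h g" if "y \<in> kernel G H h #> g" for y
      using that g by (auto simp: r_coset_def kernel_def)
    moreover have "g \<in> kernel G H h #> g" using g subgroup_kernel by (rule G.rcos_self)
    ultimately have "h ` (kernel G H h #> g) = {h g}" by blast
    then show ?thesis by simp
  qed
  then have "(\<lambda>C. the_elem (h ` C)) ` carrier (G Mod kernel G H h) = h ` carrier G"
    by (simp add: carrier_FactGroup image_image)
  then have "card (h ` carrier G) = card (carrier (G Mod kernel G H h))"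
    using card_image[OF FactGroup_inj_on] by simp
  then show ?thesis
    using G.lagrange[OF subgroup_kernel] by (simp add: FactGroup_def)
qed

lemma (in group_hom) card_image_dvd_order: "card (h ` carrier G) dvd order G"
  using card_image_kernel dvd_triv_left by metis

section \<open>Transfer\<close>

text \<open>On each double coset P k P with chosen representative k, put \<open>\<Psi>\<close> (x k
  u) = f x f u. Both equivariance laws are then built in, and the fusion hypothesis is what makes
  the value independent of x and u.\<close>

lemma (in group) bi_equivariant_function:
  assumes P: "subgroup P G" and B: "comm_group B" and f: "f \<in> hom (G\<lparr>carrier := P\<rparr>) B"
    and fusion: "\<And>g x. g \<in> carrier G \<Longrightarrow> x \<in> P \<Longrightarrow> g \<otimes> x \<otimes> inv g \<in> P \<Longrightarrow> f (g \<otimes> x \<otimes> inv g) = f x"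
  obtains \<Psi> where "\<Psi> \<in> carrier G \<rightarrow> carrier B"
    and "\<And>x g. x \<in> P \<Longrightarrow> g \<in> carrier G \<Longrightarrow> \<Psi> (x \<otimes> g) = f x \<otimes>\<^bsub>B\<^esub> \<Psi> g"
    and "\<And>x g. x \<in> P \<Longrightarrow> g \<in> carrier G \<Longrightarrow> \<Psi> (g \<otimes> x) = \<Psi> g \<otimes>\<^bsub>B\<^esub> f x"
proof -
  interpret B: comm_group B by (rule B)
  interpret P: subgroup P G by (rule P)
  have f_closed [simp]: "f x \<in> carrier B" if "x \<in> P" for x
    using f that by (auto simp: hom_def)
  have f_mult: "f (x \<otimes> y) = f x \<otimes>\<^bsub>B\<^esub> f y" if "x \<in> P" "y \<in> P" for x y
    using f that by (auto simp: hom_def)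
  define D where "D g = {x \<otimes> g \<otimes> u |x u. x \<in> P \<and> u \<in> P}" for g
  \<comment> \<open>The choice depends on g only through its double coset \<open>D g\<close>, so all
    elements of a double coset receive the same representative.\<close>
  define r where "r g = (SOME h. h \<in> D g)" for g
  have D_eq: "D (x \<otimes> g \<otimes> u) = D g" if "x \<in> P" "u \<in> P" "g \<in> carrier G" for x g u
  proof (intro equalityI subsetI)
    fix h assume "h \<in> D (x \<otimes> g \<otimes> u)"
    then obtain a b where "h = a \<otimes> (x \<otimes> g \<otimes> u) \<otimes> b" "a \<in> P" "b \<in> P" by (auto simp: D_def)
    then have "h = (a \<otimes> x) \<otimes> g \<otimes> (u \<otimes> b)" "a \<otimes> x \<in> P" "u \<otimes> b \<in> P"
      using that by (simp_all add: m_assoc)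
    then show "h \<in> D g" unfolding D_def by blast
  next
    fix h assume "h \<in> D g"
    then obtain a b where ab: "h = a \<otimes> g \<otimes> b" "a \<in> P" "b \<in> P" by (auto simp: D_def)
    have cancel: "inv x \<otimes> (x \<otimes> y) = y" "u \<otimes> (inv u \<otimes> y) = y" if "y \<in> carrier G" for y
      using \<open>x \<in> P\<close> \<open>u \<in> P\<close> that by (simp_all flip: m_assoc)
    have "h = (a \<otimes> inv x) \<otimes> (x \<otimes> g \<otimes> u) \<otimes> (inv u \<otimes> b)"
      using that ab by (simp add: m_assoc cancel)
    moreover have "a \<otimes> inv x \<in> P" "inv u \<otimes> b \<in> P" using that ab by simp_all
    ultimately show "h \<in> D (x \<otimes> g \<otimes> u)" unfolding D_def by blast
  qed
  have rD: "r g \<in> D g" if "g \<in> carrier G" for g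
  proof -
    have "\<one> \<otimes> g \<otimes> \<one> \<in> D g" unfolding D_def using P.one_closed by blast
    then show ?thesis unfolding r_def by (rule someI)
  qed
  then have rG: "r g \<in> carrier G" if "g \<in> carrier G" for g
    using that by (fastforce simp: D_def)
  have decomp: "\<exists>x\<in>P. \<exists>u\<in>P. g = x \<otimes> r g \<otimes> u" if g: "g \<in> carrier G" for g
  proof -
    obtain x u where "r g = x \<otimes> g \<otimes> u" "x \<in> P" "u \<in> P" using rD[OF g] by (auto simp: D_def)
    then have "D (r g) = D g" using D_eq g by simp
    moreover have "\<one> \<otimes> g \<otimes> \<one> \<in> D g" unfolding D_def using P.one_closed by blast
    ultimately have "g \<in> D (r g)" using g by simp
    then show ?thesis by (auto simp: D_def)
  qed
  have r_eq: "r (x \<otimes> g \<otimes> u) = r g" if "x \<in> P" "u \<in> P" "g \<in> carrier G" for x g u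
    unfolding r_def using D_eq[OF that] by simp
  \<comment> \<open>From x k u = y k v one gets k (v u^-1) k^-1 = y^-1 x. Both v u^-1 and y^-1 x lie
    in P and are conjugate in G, so f agrees on them.\<close>
  have unique: "f x \<otimes>\<^bsub>B\<^esub> f u = f y \<otimes>\<^bsub>B\<^esub> f v"
    if eq: "x \<otimes> k \<otimes> u = y \<otimes> k \<otimes> v" and P4: "x \<in> P" "u \<in> P" "y \<in> P" "v \<in> P" and k: "k \<in> carrier G" for x u y v k
  proof -
    have cancel: "inv z \<otimes> (z \<otimes> w) = w" "z \<otimes> (inv z \<otimes> w) = w"
      if "z \<in> carrier G" "w \<in> carrier G" for z w
      using that by (simp_all flip: m_assoc)
    have "k \<otimes> (v \<otimes> inv u) \<otimes> inv k = inv y \<otimes> (y \<otimes> k \<otimes> v) \<otimes> inv u \<otimes> inv k"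
      using P4 k by (simp add: m_assoc cancel)
    also have "\<dots> = inv y \<otimes> x"
      unfolding eq[symmetric] using P4 k by (simp add: m_assoc cancel)
    finally have *: "k \<otimes> (v \<otimes> inv u) \<otimes> inv k = inv y \<otimes> x" .
    have "f (v \<otimes> inv u) = f (inv y \<otimes> x)"
      using fusion[of k "v \<otimes> inv u"] * P4 k by simp
    then have "f y \<otimes>\<^bsub>B\<^esub> f (v \<otimes> inv u) \<otimes>\<^bsub>B\<^esub> f u = f y \<otimes>\<^bsub>B\<^esub> f (inv y \<otimes> x) \<otimes>\<^bsub>B\<^esub> f u" by simp
    moreover have "f y \<otimes>\<^bsub>B\<^esub> f (v \<otimes> inv u) \<otimes>\<^bsub>B\<^esub> f u = f (y \<otimes> (v \<otimes> inv u) \<otimes> u)"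
      using P4 by (simp add: f_mult)
    moreover have "f y \<otimes>\<^bsub>B\<^esub> f (inv y \<otimes> x) \<otimes>\<^bsub>B\<^esub> f u = f (y \<otimes> (inv y \<otimes> x) \<otimes> u)"
      using P4 by (simp add: f_mult)
    moreover have "y \<otimes> (v \<otimes> inv u) \<otimes> u = y \<otimes> v" "y \<otimes> (inv y \<otimes> x) \<otimes> u = x \<otimes> u"
      using P4 by (simp_all add: m_assoc cancel)
    ultimately show ?thesis using P4 by (simp add: f_mult)
  qed
  define \<Psi> where "\<Psi> g = (SOME b. \<exists>x\<in>P. \<exists>u\<in>P. g = x \<otimes> r g \<otimes> u \<and> b = f x \<otimes>\<^bsub>B\<^esub> f u)" for g
  have \<Psi>: "\<Psi> g = f x \<otimes>\<^bsub>B\<^esub> f u" if g: "g \<in> carrier G" and xu: "x \<in> P" "u \<in> P" "g = x \<otimes> r g \<otimes> u" for g x u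
  proof -
    have "\<exists>b. \<exists>x\<in>P. \<exists>u\<in>P. g = x \<otimes> r g \<otimes> u \<and> b = f x \<otimes>\<^bsub>B\<^esub> f u" using xu by blast
    then have "\<exists>x\<in>P. \<exists>u\<in>P. g = x \<otimes> r g \<otimes> u \<and> \<Psi> g = f x \<otimes>\<^bsub>B\<^esub> f u"
      unfolding \<Psi>_def by (rule someI_ex)
    then obtain y v where yv: "y \<in> P" "v \<in> P" "g = y \<otimes> r g \<otimes> v" "\<Psi> g = f y \<otimes>\<^bsub>B\<^esub> f v" by blast
    show ?thesis
      using unique[of y "r g" v x u] yv xu rG[OF g] by simp
  qed
  show thesis
  proof (rule that)
    show "\<Psi> \<in> carrier G \<rightarrow> carrier B"
      using decomp \<Psi> by fastforce
  next
    fix x g assume x: "x \<in> P" and g: "g \<in> carrier G"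
    obtain y u where yu: "y \<in> P" "u \<in> P" "g = y \<otimes> r g \<otimes> u" using decomp[OF g] by blast
    have "r (x \<otimes> g) = r g" using r_eq[of x \<one> g] x g by simp
    then have "x \<otimes> g = (x \<otimes> y) \<otimes> r (x \<otimes> g) \<otimes> u" using x yu rG[OF g] by (metis P.mem_carrier m_assoc m_closed)
    then have "\<Psi> (x \<otimes> g) = f (x \<otimes> y) \<otimes>\<^bsub>B\<^esub> f u" using \<Psi>[of "x \<otimes> g" "x \<otimes> y" u] x yu g by simp
    then show "\<Psi> (x \<otimes> g) = f x \<otimes>\<^bsub>B\<^esub> \<Psi> g" using \<Psi>[OF g yu] x yu(1,2) by (simp add: f_mult B.m_assoc)
    have "r (g \<otimes> x) = r g" using r_eq[of \<one> x g] x g by simp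
    then have "g \<otimes> x = y \<otimes> r (g \<otimes> x) \<otimes> (u \<otimes> x)" using x yu rG[OF g] by (metis P.mem_carrier m_assoc m_closed)
    then have "\<Psi> (g \<otimes> x) = f y \<otimes>\<^bsub>B\<^esub> f (u \<otimes> x)" using \<Psi>[of "g \<otimes> x" y "u \<otimes> x"] x yu g by simp
    then show "\<Psi> (g \<otimes> x) = \<Psi> g \<otimes>\<^bsub>B\<^esub> f x" using \<Psi>[OF g yu] x yu(1,2) by (simp add: f_mult B.m_assoc)
  qed
qed

text \<open>A function \<open>\<Psi>\<close> that is equivariant on both sides replaces a transversal: no cycle decomposition
  is needed to evaluate the transfer on P.\<close>

lemma (in group) transfer_hom:
  assumes P: "subgroup P G" and B: "comm_group B" and f: "f \<in> hom (G\<lparr>carrier := P\<rparr>) B"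
    and fusion: "\<And>g x. g \<in> carrier G \<Longrightarrow> x \<in> P \<Longrightarrow> g \<otimes> x \<otimes> inv g \<in> P \<Longrightarrow> f (g \<otimes> x \<otimes> inv g) = f x"
  obtains V where "V \<in> hom G B" "\<And>x. x \<in> P \<Longrightarrow> V x = f x [^]\<^bsub>B\<^esub> card (rcosets P)"
proof -
  interpret B: comm_group B by (rule B)
  interpret P: subgroup P G by (rule P)
  have f_closed [simp]: "f x \<in> carrier B" if "x \<in> P" for x
    using f that by (auto simp: hom_def)
  obtain \<Psi> where \<Psi>_closed: "\<Psi> \<in> carrier G \<rightarrow> carrier B"
    and \<Psi>_left: "\<And>x g. x \<in> P \<Longrightarrow> g \<in> carrier G \<Longrightarrow> \<Psi> (x \<otimes> g) = f x \<otimes>\<^bsub>B\<^esub> \<Psi> g"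
    and \<Psi>_right: "\<And>x g. x \<in> P \<Longrightarrow> g \<in> carrier G \<Longrightarrow> \<Psi> (g \<otimes> x) = \<Psi> g \<otimes>\<^bsub>B\<^esub> f x"
    using P B f fusion by (rule bi_equivariant_function) blast+
  have [simp]: "\<Psi> g \<in> carrier B" if "g \<in> carrier G" for g using \<Psi>_closed that by blast
  \<comment> \<open>Replacing c by x c with x in P multiplies both factors by f x, which cancels in
    the abelian group B. Thus the value belongs to the coset alone.\<close>
  define \<phi> where "\<phi> y C = \<Psi> ((SOME c. c \<in> C) \<otimes> y) \<otimes>\<^bsub>B\<^esub> inv\<^bsub>B\<^esub> \<Psi> (SOME c. c \<in> C)" for y C
  have \<phi>_eq: "\<phi> y (P #> g) = \<Psi> (g \<otimes> y) \<otimes>\<^bsub>B\<^esub> inv\<^bsub>B\<^esub> \<Psi> g" if "g \<in> carrier G" "y \<in> carrier G" for g y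
  proof -
    have "(SOME c. c \<in> P #> g) \<in> P #> g" using rcos_self[OF that(1) P] by (rule someI)
    then obtain x where x: "x \<in> P" "(SOME c. c \<in> P #> g) = x \<otimes> g" by (auto simp: r_coset_def)
    have "\<phi> y (P #> g) = f x \<otimes>\<^bsub>B\<^esub> \<Psi> (g \<otimes> y) \<otimes>\<^bsub>B\<^esub> inv\<^bsub>B\<^esub> (f x \<otimes>\<^bsub>B\<^esub> \<Psi> g)"
      unfolding \<phi>_def x(2) using x(1) that by (simp add: \<Psi>_left m_assoc)
    also have "\<dots> = (f x \<otimes>\<^bsub>B\<^esub> inv\<^bsub>B\<^esub> f x) \<otimes>\<^bsub>B\<^esub> (\<Psi> (g \<otimes> y) \<otimes>\<^bsub>B\<^esub> inv\<^bsub>B\<^esub> \<Psi> g)"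
      using x(1) that by (simp only: B.inv_mult B.m_ac f_closed B.inv_closed B.m_closed \<open>\<And>g. g \<in> carrier G \<Longrightarrow> \<Psi> g \<in> carrier B\<close> m_closed)
    finally show ?thesis using x(1) that by simp
  qed
  have \<phi>_closed: "\<phi> y \<in> rcosets P \<rightarrow> carrier B" if "y \<in> carrier G" for y
    using that by (auto simp: RCOSETS_def \<phi>_eq)
  have \<phi>_mem: "\<phi> y C \<in> carrier B" if "y \<in> carrier G" "C \<in> rcosets P" for y C
    using \<phi>_closed[OF that(1)] that(2) by (rule funcset_mem)
  define V where "V y = finprod B (\<phi> y) (rcosets P)" for y
  have shift: "(\<lambda>C. C #> y) ` (rcosets P) = rcosets P" "inj_on (\<lambda>C. C #> y) (rcosets P)" if y: "y \<in> carrier G" for y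
  proof -
    have inverse: "C #> y #> inv y = C" "C #> inv y #> y = C" "C #> y \<in> rcosets P" "C #> inv y \<in> rcosets P"
      if C: "C \<in> rcosets P" for C
      using C y P.subset by (auto simp: RCOSETS_def coset_mult_assoc m_assoc)
    show "inj_on (\<lambda>C. C #> y) (rcosets P)"
      using inverse(1) by (rule inj_on_inverseI)
    show "(\<lambda>C. C #> y) ` (rcosets P) = rcosets P"
    proof (intro equalityI subsetI)
      fix C assume C: "C \<in> rcosets P"
      show "C \<in> (\<lambda>C. C #> y) ` (rcosets P)"
        using inverse(2)[OF C, symmetric] inverse(4)[OF C] by (rule image_eqI)
    qed (use inverse(3) in blast)
  qed
  have "V \<in> hom G B"
  proof (rule homI)
    fix y assume "y \<in> carrier G"
    then show "V y \<in> carrier B" unfolding V_def using \<phi>_closed by (intro B.finprod_closed)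
  next
    fix y z assume yz: "y \<in> carrier G" "z \<in> carrier G"
    have shift_mem: "C #> y \<in> rcosets P" if "C \<in> rcosets P" for C
      using imageI[OF that, of "\<lambda>C. C #> y"] unfolding shift(1)[OF yz(1)] .
    have cancel: "inv\<^bsub>B\<^esub> a \<otimes>\<^bsub>B\<^esub> (a \<otimes>\<^bsub>B\<^esub> b) = b" if "a \<in> carrier B" "b \<in> carrier B" for a b
      using that by (simp flip: B.m_assoc)
    \<comment> \<open>\<open>\<phi>\<close> is a cocycle: inserting \<open>\<Psi>\<close> (c y) and
      its inverse splits the factor for y z. Since C \<mapsto> C y permutes the cosets, the first
      product is V z.\<close>
    have "V (y \<otimes> z) = finprod B (\<lambda>C. \<phi> z (C #> y) \<otimes>\<^bsub>B\<^esub> \<phi> y C) (rcosets P)"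
      unfolding V_def
    proof (rule B.finprod_cong')
      show "(\<lambda>C. \<phi> z (C #> y) \<otimes>\<^bsub>B\<^esub> \<phi> y C) \<in> rcosets P \<rightarrow> carrier B"
        by (rule Pi_I) (simp add: \<phi>_mem shift_mem yz)
      fix C assume "C \<in> rcosets P"
      then obtain c where c: "c \<in> carrier G" "C = P #> c" by (auto simp: RCOSETS_def)
      have "\<phi> (y \<otimes> z) C = \<Psi> (c \<otimes> y \<otimes> z) \<otimes>\<^bsub>B\<^esub> inv\<^bsub>B\<^esub> \<Psi> c"
        using c yz by (simp add: \<phi>_eq m_assoc)
      also have "\<dots> = (\<Psi> (c \<otimes> y \<otimes> z) \<otimes>\<^bsub>B\<^esub> inv\<^bsub>B\<^esub> \<Psi> (c \<otimes> y)) \<otimes>\<^bsub>B\<^esub> (\<Psi> (c \<otimes> y) \<otimes>\<^bsub>B\<^esub> inv\<^bsub>B\<^esub> \<Psi> c)"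
        using c yz by (simp add: B.m_assoc cancel)
      also have "\<dots> = \<phi> z (C #> y) \<otimes>\<^bsub>B\<^esub> \<phi> y C"
        using c yz P.subset by (simp add: \<phi>_eq coset_mult_assoc)
      finally show "\<phi> (y \<otimes> z) C = \<phi> z (C #> y) \<otimes>\<^bsub>B\<^esub> \<phi> y C" .
    qed simp
    also have "\<dots> = finprod B (\<lambda>C. \<phi> z (C #> y)) (rcosets P) \<otimes>\<^bsub>B\<^esub> V y"
      unfolding V_def by (intro B.finprod_multf Pi_I) (simp_all add: \<phi>_mem shift_mem yz)
    also have "finprod B (\<lambda>C. \<phi> z (C #> y)) (rcosets P) = V z"
      unfolding V_def using B.finprod_reindex[of "\<phi> z" "\<lambda>C. C #> y" "rcosets P"] shift[OF yz(1)] \<phi>_closed[OF yz(2)]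
      by simp
    also have "V z \<otimes>\<^bsub>B\<^esub> V y = V y \<otimes>\<^bsub>B\<^esub> V z"
      unfolding V_def using \<phi>_closed yz by (intro B.m_comm B.finprod_closed)
    finally show "V (y \<otimes> z) = V y \<otimes>\<^bsub>B\<^esub> V z" .
  qed
  moreover have "V x = f x [^]\<^bsub>B\<^esub> card (rcosets P)" if x: "x \<in> P" for x
  proof -
    \<comment> \<open>Right equivariance makes every factor equal to f x, so the product over all
      cosets is a power with the index as exponent.\<close>
    have "\<phi> x C = f x" if C: "C \<in> rcosets P" for C
    proof -
      obtain c where c: "c \<in> carrier G" "C = P #> c" using C by (auto simp: RCOSETS_def)
      have "\<phi> x C = f x \<otimes>\<^bsub>B\<^esub> \<Psi> c \<otimes>\<^bsub>B\<^esub> inv\<^bsub>B\<^esub> \<Psi> c"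
        using c x by (simp add: \<phi>_eq \<Psi>_right B.m_comm)
      then show ?thesis using c x by (simp add: B.m_assoc)
    qed
    then have "V x = finprod B (\<lambda>C. f x) (rcosets P)"
      unfolding V_def using x by (intro B.finprod_cong') auto
    then show ?thesis using x by (simp add: B.finprod_const)
  qed
  ultimately show thesis using that by blast
qed

section \<open>Minimal counterexamples\<close>

text \<open>Phrased for all proper subgroups so that it applies directly to normalizers and to
  preimages under quotient maps.\<close>

definition p_proper_nilpotent :: "nat \<Rightarrow> ('a, 'b) monoid_scheme \<Rightarrow> bool" where
  "p_proper_nilpotent p G \<longleftrightarrow> (\<forall>K. subgroup K G \<and> K \<noteq> carrier G \<and> p dvd card K
     \<longrightarrow> nilpotent_group (G\<lparr>carrier := K\<rparr>))"

text \<open>\<open>no_solvable_normal\<close> carries the non-solvability of G as well: taking N to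
  be all of G would make a solvable G trivial, against p dividing its order.\<close>

locale critical_group = group G for G (structure) +
  fixes p :: nat
  assumes finite_carrier: "finite (carrier G)"
    and prime_p: "Factorial_Ring.prime p"
    and p_dvd_order: "p dvd order G"
    and proper_nilpotent: "p_proper_nilpotent p G"
    and no_solvable_normal: "\<And>N. N \<lhd> G \<Longrightarrow> solvable (G\<lparr>carrier := N\<rparr>) \<Longrightarrow> N = {\<one>}"
begin

lemma nilpotent_if_proper:
  assumes "subgroup K G" "K \<noteq> carrier G" "p dvd card K"
  shows "nilpotent_group (G\<lparr>carrier := K\<rparr>)"
  using proper_nilpotent assms by (simp add: p_proper_nilpotent_def)

lemma no_prime_power_normal:
  assumes "Factorial_Ring.prime q" "Q \<lhd> G" "card Q = q ^ k"
  shows "Q = {\<one>}"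
proof (cases k)
  case 0
  then show ?thesis
    using assms(3) subgroup.one_closed[OF normal_imp_subgroup[OF assms(2)]]
    by (auto simp: card_1_singleton_iff)
next
  case (Suc k')
  then show ?thesis
    using normal_prime_power_subgroup_center[OF assms] no_solvable_normal by auto
qed

lemma normalizer_prime_power_proper:
  assumes "Factorial_Ring.prime q" "subgroup Q G" "card Q = q ^ k" "Q \<noteq> {\<one>}"
  shows "normalizer G Q \<noteq> carrier G"
  using no_prime_power_normal[OF assms(1) _ assms(3)] assms(4) normal_iff_normalizer_eq_carrier[OF assms(2)]
  by blast

lemma finite_subgroup: "subgroup K G \<Longrightarrow> finite K"
  using finite_carrier finite_subset subgroup.subset by blast

lemma normalizer_nilpotent:
  assumes "subgroup D G" "card D = p ^ k" "D \<noteq> {\<one>}"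
  shows "nilpotent_group (G\<lparr>carrier := normalizer G D\<rparr>)"
proof (rule nilpotent_if_proper)
  show sub: "subgroup (normalizer G D) G"
    using subgroup.subset[OF assms(1)] by (rule normalizer_imp_subgroup)
  show "normalizer G D \<noteq> carrier G"
    using prime_p assms by (rule normalizer_prime_power_proper)
  have "k \<noteq> 0"
  proof
    assume "k = 0"
    then show False
      using assms(2,3) subgroup.one_closed[OF assms(1)] by (auto simp: card_1_singleton_iff)
  qed
  then have "p dvd card D" using assms(2) by simp
  also have "card D dvd card (normalizer G D)"
    using assms(1) sub subgroup_subset_normalizer[OF assms(1)] by (rule subgroup_card_dvd)
  finally show "p dvd card (normalizer G D)" .
qed

lemma sylow_proper_nontrivial:
  assumes "sylow_subgroup G p S"
  shows "S \<noteq> {\<one>}" "S \<noteq> carrier G" "p dvd card S"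
proof -
  have S: "subgroup S G" "card S = p ^ multiplicity p (order G)"
    using assms by (auto simp: sylow_subgroup_def)
  have "order G \<noteq> 0" using finite_carrier order_gt_0_iff_finite by simp
  then have "multiplicity p (order G) > 0"
    using prime_p p_dvd_order by (simp add: prime_multiplicity_gt_zero_iff)
  then show dvd: "p dvd card S" using S(2) by simp
  then show "S \<noteq> {\<one>}" using prime_gt_1_nat[OF prime_p] by auto
  \<comment> \<open>Otherwise G would be a normal p-subgroup of itself, hence trivial.\<close>
  then show "S \<noteq> carrier G"
    using no_prime_power_normal[OF prime_p _ S(2)] normal_self by blast
qed

text \<open>The induction treats large intersections before small ones. For D the intersection of R
  and S, the nilpotent normalizer of D has a normal Sylow p-subgroup, which lies in some Sylow
  p-subgroup T of G. Normalizers grow in R and in S, so each meets T in more than D, and by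
  induction both equal T.\<close>

lemma sylow_trivial_intersection:
  assumes "sylow_subgroup G p R" "sylow_subgroup G p S" "R \<inter> S \<noteq> {\<one>}"
  shows "R = S"
  using assms
proof (induction "order G - card (R \<inter> S)" arbitrary: R S rule: less_induct)
  case less
  have R: "subgroup R G" "card R = p ^ multiplicity p (order G)"
    and S: "subgroup S G" "card S = p ^ multiplicity p (order G)"
    using less.prems by (auto simp: sylow_subgroup_def)
  define D where "D = R \<inter> S"
  have D: "subgroup D G" "D \<noteq> {\<one>}" using R(1) S(1) less.prems(3) by (auto simp: D_def subgroups_Inter_pair)
  have "card D dvd p ^ multiplicity p (order G)"
    using subgroup_card_dvd[OF D(1) R(1)] R(2) by (simp add: D_def)
  then obtain j where j: "card D = p ^ j"
    using divides_primepow_nat[OF prime_p] by blast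
  define M where "M = normalizer G D"
  have M: "subgroup M G" "D \<subseteq> M" "nilpotent_group (G\<lparr>carrier := M\<rparr>)"
    using normalizer_imp_subgroup[OF subgroup.subset[OF D(1)]] subgroup_subset_normalizer[OF D(1)]
      normalizer_nilpotent[OF D(1) j D(2)] by (auto simp: M_def)
  interpret M: group "G\<lparr>carrier := M\<rparr>" by (rule subgroup_imp_group[OF M(1)])
  have finM: "finite (carrier (G\<lparr>carrier := M\<rparr>))" using finite_subgroup[OF M(1)] by simp
  obtain T0 where T0: "sylow_subgroup (G\<lparr>carrier := M\<rparr>) p T0"
    using prime_p finM by (rule M.sylow_subgroup_exists)
  have T0normal: "T0 \<lhd> G\<lparr>carrier := M\<rparr>"
    using M(3) prime_p finM T0 by (rule M.nilpotent_sylow_normal)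
  have "subgroup T0 G" "card T0 = p ^ multiplicity p (order (G\<lparr>carrier := M\<rparr>))"
    using T0 incl_subgroup[OF M(1)] by (auto simp: sylow_subgroup_def)
  then obtain T where T: "sylow_subgroup G p T" "T0 \<subseteq> T"
    using prime_p finite_carrier by (metis subset_sylow_subgroup)
  have key: "Y = T" if Y: "sylow_subgroup G p Y" "D \<subseteq> Y" "D \<noteq> Y" for Y
  proof -
    have subY: "subgroup Y G" "card Y = p ^ multiplicity p (order G)"
      using Y(1) by (auto simp: sylow_subgroup_def)
    interpret Y: group "G\<lparr>carrier := Y\<rparr>" by (rule subgroup_imp_group[OF subY(1)])
    have "nilpotent_group (G\<lparr>carrier := Y\<rparr>)"
      using subY(1) sylow_proper_nontrivial[OF Y(1)] by (intro nilpotent_if_proper)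
    moreover have "subgroup D (G\<lparr>carrier := Y\<rparr>)" using D(1) subY(1) Y(2) by (rule subgroup_incl)
    ultimately obtain x where x: "x \<in> Y" "x \<notin> D"
      and "\<And>d. d \<in> D \<Longrightarrow> x \<otimes> d \<otimes> inv\<^bsub>G\<lparr>carrier := Y\<rparr>\<^esub> x \<in> D"
      using Y.nilpotent_normalizes_larger[of D] Y(3) by auto
    then have "x \<otimes> d \<otimes> inv x \<in> D" if "d \<in> D" for d
      using that subY(1) by simp
    then have xM: "x \<in> M"
      unfolding M_def using subgroup.mem_carrier[OF subY(1) x(1)]
      by (intro normalizerI finite_subgroup[OF D(1)] subgroup.subset[OF D(1)])
    have subMY: "subgroup (M \<inter> Y) G" using M(1) subY(1) by (rule subgroups_Inter_pair)
    have "card (M \<inter> Y) dvd p ^ multiplicity p (order G)"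
      using subgroup_card_dvd[OF subMY subY(1)] subY(2) by simp
    then obtain i where i: "card (M \<inter> Y) = p ^ i"
      using divides_primepow_nat[OF prime_p] by blast
    have "subgroup (M \<inter> Y) (G\<lparr>carrier := M\<rparr>)" using subMY M(1) by (rule subgroup_incl) blast
    \<comment> \<open>A normal Sylow p-subgroup of M contains every p-subgroup of M, in particular
      the elements of Y that normalize D.\<close>
    then have "M \<inter> Y \<subseteq> T0"
      using M.normal_sylow_subgroup_contains[OF prime_p finM T0 T0normal _ i] by simp
    then have "insert x D \<subseteq> T \<inter> Y" using T(2) M(2) Y(2) x(1) xM by blast
    moreover have fin: "finite (T \<inter> Y)" using finite_subgroup[OF subY(1)] by blast
    ultimately have card: "card D < card (T \<inter> Y)"
      using card_mono[OF fin, of "insert x D"] x(2) finite_subgroup[OF D(1)] by simp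
    have "card (T \<inter> Y) \<le> order G"
      unfolding order_def using subgroup.subset[OF subY(1)] by (intro card_mono finite_carrier) blast
    then have "order G - card (T \<inter> Y) < order G - card (R \<inter> S)"
      using card by (simp add: D_def)
    moreover have "T \<inter> Y \<noteq> {\<one>}"
    proof
      assume "T \<inter> Y = {\<one>}"
      then have "D \<subseteq> {\<one>}" using \<open>insert x D \<subseteq> T \<inter> Y\<close> by blast
      then show False using D(2) subgroup.one_closed[OF D(1)] by blast
    qed
    ultimately show ?thesis using less.hyps[OF _ T(1) Y(1)] by simp
  qed
  show ?case
  proof (rule ccontr)
    assume ne: "R \<noteq> S"
    have "D \<noteq> R" "D \<noteq> S"
      using ne R(2) S(2) finite_subgroup[OF R(1)] finite_subgroup[OF S(1)]
        card_subset_eq[of S R] card_subset_eq[of R S] by (auto simp: D_def)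
    then show False
      using key[OF less.prems(1)] key[OF less.prems(2)] ne by (simp add: D_def)
  qed
qed

text \<open>The element g x g^-1 is a nontrivial common member of P and its conjugate by g, so these
  two Sylow subgroups coincide.\<close>

lemma fusion_in_normalizer:
  assumes P: "sylow_subgroup G p P" and g: "g \<in> carrier G"
    and x: "x \<in> P" "x \<noteq> \<one>" "g \<otimes> x \<otimes> inv g \<in> P"
  shows "g \<in> normalizer G P"
proof -
  have sub: "subgroup P G" using P by (simp add: sylow_subgroup_def)
  have xG: "x \<in> carrier G" using subgroup.mem_carrier[OF sub x(1)] .
  have "g \<otimes> x \<otimes> inv g \<noteq> g \<otimes> \<one> \<otimes> inv g"
    using inj_onD[OF conjugation_inj_on[OF g order_refl]] x(2) xG one_closed by blast
  then have "g \<otimes> x \<otimes> inv g \<noteq> \<one>" using g by simp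
  then have "(\<lambda>h. g \<otimes> h \<otimes> inv g) ` P \<inter> P \<noteq> {\<one>}"
    using x by blast
  then have "(\<lambda>h. g \<otimes> h \<otimes> inv g) ` P = P"
    using sylow_trivial_intersection[OF conjugate_sylow_subgroup[OF P g] P] by blast
  then show ?thesis using mem_normalizer_iff[OF subgroup.subset[OF sub]] g by simp
qed

end

section \<open>The transfer of a critical group and the final contradiction\<close>

context critical_group
begin

lemma transfer_to_p_group:
  obtains B :: "'a set monoid" and V j
  where "group_hom G B V" "order B = p ^ j" "kernel G B V \<noteq> carrier G"
proof -
  obtain P where P: "sylow_subgroup G p P"
    using prime_p finite_carrier by (rule sylow_subgroup_exists)
  then have subP: "subgroup P G" and cardP: "card P = p ^ multiplicity p (order G)"
    by (auto simp: sylow_subgroup_def)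
  interpret P: subgroup P G by (rule subP)
  interpret PG: group "G\<lparr>carrier := P\<rparr>" by (rule subgroup_imp_group[OF subP])
  have finP: "finite P" by (rule finite_subgroup[OF subP])
  define M where "M = normalizer G P"
  have subM: "subgroup M G" and PM: "P \<subseteq> M" and nilM: "nilpotent_group (G\<lparr>carrier := M\<rparr>)"
    using normalizer_imp_subgroup[OF subgroup.subset[OF subP]] subgroup_subset_normalizer[OF subP]
      normalizer_nilpotent[OF subP cardP sylow_proper_nontrivial(1)[OF P]] by (auto simp: M_def)
  interpret M: group "G\<lparr>carrier := M\<rparr>" by (rule subgroup_imp_group[OF subM])
  have conjP: "g \<otimes> x \<otimes> inv g \<in> P" if "g \<in> M" "x \<in> P" for g x
    using normalizer_conj_closed[OF P.subset] that by (simp add: M_def)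
  \<comment> \<open>Commutators of P with M, not just with P: the quotient P/A is abelian and the
    quotient map is constant on M-conjugates in P.\<close>
  define A where "A = commutator_subgroup G P M"
  have "commutator_subgroup (G\<lparr>carrier := M\<rparr>) P (carrier (G\<lparr>carrier := M\<rparr>)) \<subset> P"
  proof (rule M.commutator_subgroup_nilpotent_psubset[OF nilM])
    show "subgroup P (G\<lparr>carrier := M\<rparr>)" using subP subM PM by (rule subgroup_incl)
    show "P \<noteq> {\<one>\<^bsub>G\<lparr>carrier := M\<rparr>\<^esub>}" using sylow_proper_nontrivial(1)[OF P] by simp
    show "g \<otimes>\<^bsub>G\<lparr>carrier := M\<rparr>\<^esub> x \<otimes>\<^bsub>G\<lparr>carrier := M\<rparr>\<^esub> inv\<^bsub>G\<lparr>carrier := M\<rparr>\<^esub> g \<in> P"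
      if "g \<in> carrier (G\<lparr>carrier := M\<rparr>)" "x \<in> P" for g x
      using that conjP subM by simp
  qed
  then have AP: "A \<subset> P"
    using commutator_subgroup_consistent[OF subM PM order_refl] by (simp add: A_def)
  have subA: "subgroup A G"
    unfolding A_def using P.subset subgroup.subset[OF subM] by (rule commutator_subgroup_is_subgroup)
  interpret A: subgroup A G by (rule subA)
  have comm: "x \<otimes> g \<otimes> inv x \<otimes> inv g \<in> A" if "x \<in> P" "g \<in> M" for x g
    unfolding A_def using that by (rule commutator_in_commutator_subgroup)
  have coset_eq: "A #> x = A #> y" if "x \<otimes> inv y \<in> A" "x \<in> carrier G" "y \<in> carrier G" for x y
  proof -
    have "x \<in> A #> y" using group_axioms that(3,2,1) by (rule A.rcos_module_rev)
    then show ?thesis using that(3) subA by (rule repr_independence[symmetric])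
  qed
  have normA: "A \<lhd> G\<lparr>carrier := P\<rparr>"
  proof (rule PG.normal_invI)
    show "subgroup A (G\<lparr>carrier := P\<rparr>)" using subA subP AP by (intro subgroup_incl) auto
    fix x a assume x: "x \<in> carrier (G\<lparr>carrier := P\<rparr>)" and a: "a \<in> A"
    have aP: "a \<in> P" using a AP by blast
    have "x \<otimes> a \<otimes> inv x \<otimes> inv a \<in> A"
      using comm[of x a] x subsetD[OF PM aP] by simp
    then have "x \<otimes> a \<otimes> inv x \<otimes> inv a \<otimes> a \<in> A" using a by (rule A.m_closed)
    then have "x \<otimes> a \<otimes> inv x \<in> A" using x aP by (simp add: m_assoc)
    then show "x \<otimes>\<^bsub>G\<lparr>carrier := P\<rparr>\<^esub> a \<otimes>\<^bsub>G\<lparr>carrier := P\<rparr>\<^esub> inv\<^bsub>G\<lparr>carrier := P\<rparr>\<^esub> x \<in> A"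
      using x subP by simp
  qed
  interpret AP: normal A "G\<lparr>carrier := P\<rparr>" by (rule normA)
  define B where "B = (G\<lparr>carrier := P\<rparr>) Mod A"
  define f where "f x = A #> x" for x
  have f: "f \<in> hom (G\<lparr>carrier := P\<rparr>) B"
    using AP.r_coset_hom_Mod unfolding B_def f_def by simp
  have carrierB: "carrier B = f ` P" and oneB: "\<one>\<^bsub>B\<^esub> = A"
    by (simp_all add: B_def f_def carrier_FactGroup)
  interpret BG: group B unfolding B_def by (rule AP.factorgroup_is_group)
  have fmult: "f (x \<otimes> y) = f x \<otimes>\<^bsub>B\<^esub> f y" if "x \<in> P" "y \<in> P" for x y
    using f that by (simp add: hom_def)
  have B: "comm_group B"
  proof (rule BG.group_comm_groupI)
    fix a b assume "a \<in> carrier B" "b \<in> carrier B"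
    then obtain x y where xy: "x \<in> P" "a = f x" "y \<in> P" "b = f y" by (auto simp: carrierB)
    have "x \<otimes> y \<otimes> inv (y \<otimes> x) \<in> A"
      using comm[of x y] xy PM by (auto simp: inv_mult_group m_assoc)
    then have "f (x \<otimes> y) = f (y \<otimes> x)"
      unfolding f_def using xy by (intro coset_eq) auto
    then show "a \<otimes>\<^bsub>B\<^esub> b = b \<otimes>\<^bsub>B\<^esub> a" using xy by (simp add: fmult)
  qed
  \<comment> \<open>The identity is treated apart because its conjugates put no constraint on g; any
    other x forces g into M.\<close>
  have "f (g \<otimes> x \<otimes> inv g) = f x" if g: "g \<in> carrier G" and x: "x \<in> P" and gx: "g \<otimes> x \<otimes> inv g \<in> P" for g x
  proof (cases "x = \<one>")
    case True
    then show ?thesis using g by simp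
  next
    case False
    then have "g \<in> M" unfolding M_def using fusion_in_normalizer[OF P g x _ gx] by simp
    then have "x \<otimes> inv (g \<otimes> x \<otimes> inv g) \<in> A"
      using comm[OF x, of g] g x by (simp add: inv_mult_group m_assoc)
    then have "A #> x = A #> (g \<otimes> x \<otimes> inv g)" using g x by (intro coset_eq) auto
    then show ?thesis by (simp add: f_def)
  qed
  then obtain V where V: "V \<in> hom G B" "\<And>x. x \<in> P \<Longrightarrow> V x = f x [^]\<^bsub>B\<^esub> card (rcosets P)"
    using transfer_hom[OF subP B f] by blast
  have hom: "group_hom G B V"
    using V(1) by (simp add: group_hom_def group_hom_axioms_def BG.group_axioms)
  have "order B * card A = card P"
    using PG.lagrange[of A] AP.subgroup_axioms by (simp add: B_def FactGroup_def order_def)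
  then have "order B dvd p ^ multiplicity p (order G)"
    using cardP dvd_triv_left by metis
  then obtain j where j: "order B = p ^ j"
    using divides_primepow_nat[OF prime_p] by blast
  obtain x where x: "x \<in> P" "x \<notin> A" using AP by blast
  have fx: "f x \<in> carrier B" using x(1) by (simp add: carrierB)
  \<comment> \<open>The order of f x is a power of p while the exponent, the index of P, is prime to
    p, so the power is trivial only if f x is.\<close>
  have "V x \<noteq> \<one>\<^bsub>B\<^esub>"
  proof
    assume "V x = \<one>\<^bsub>B\<^esub>"
    then have "f x [^]\<^bsub>B\<^esub> card (rcosets P) = \<one>\<^bsub>B\<^esub>" using V(2) x(1) by simp
    then have "BG.ord (f x) dvd card (rcosets P)" using fx BG.pow_eq_id by simp
    moreover have "BG.ord (f x) dvd p ^ j" using fx BG.ord_dvd_group_order j by simp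
    moreover have "coprime (card (rcosets P)) (p ^ j)"
      using sylow_subgroup_index[OF prime_p finite_carrier P] prime_p
      by (simp add: prime_imp_coprime coprime_commute)
    ultimately have "BG.ord (f x) = 1"
      using coprime_common_divisor_nat by blast
    then have "f x = \<one>\<^bsub>B\<^esub>" using fx BG.ord_eq_1 by simp
    then show False using rcos_self[of x A] x subA oneB by (simp add: f_def)
  qed
  then have "kernel G B V \<noteq> carrier G"
    using x(1) by (auto simp: kernel_def)
  then show thesis using that[OF hom j] by blast
qed

lemma contradiction: False
proof -
  obtain B :: "'a set monoid" and V j
    where "group_hom G B V" and j: "order B = p ^ j" and ker: "kernel G B V \<noteq> carrier G"
    by (rule transfer_to_p_group)
  then interpret V: group_hom G B V by blast
  define K where "K = kernel G B V"
  have normK: "K \<lhd> G" unfolding K_def by (rule V.normal_kernel)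
  then have subK: "subgroup K G" by (rule normal_imp_subgroup)
  interpret K: group "G\<lparr>carrier := K\<rparr>" by (rule subgroup_imp_group[OF subK])
  have finK: "finite (carrier (G\<lparr>carrier := K\<rparr>))" using finite_subgroup[OF subK] by simp
  have ndvd: "\<not> p dvd card K"
  proof
    assume dvd: "p dvd card K"
    then have "solvable (G\<lparr>carrier := K\<rparr>)"
      using nilpotent_if_proper[OF subK] ker K.nilpotent_imp_solvable by (simp add: K_def)
    then have "K = {\<one>}" using no_solvable_normal normK by blast
    then show False using dvd prime_gt_1_nat[OF prime_p] by simp
  qed
  obtain P where P: "sylow_subgroup G p P"
    using prime_p finite_carrier by (rule sylow_subgroup_exists)
  then have subP: "subgroup P G" and cardP: "card P = p ^ multiplicity p (order G)"
    by (auto simp: sylow_subgroup_def)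
  interpret P: subgroup P G by (rule subP)
  define N where "N = normalizer G P"
  have subN: "subgroup N G" unfolding N_def using P.subset by (rule normalizer_imp_subgroup)
  \<comment> \<open>Taken over all primes this gives that the order of G divides that of N, so P is
    normal. The cases q = p and q not dividing the order are immediate.\<close>
  have "q ^ multiplicity q (order G) dvd card N" if q: "Factorial_Ring.prime q" for q
  proof (cases "q = p \<or> \<not> q dvd order G")
    case True
    then show ?thesis
    proof
      assume "q = p"
      then show ?thesis
        using subgroup_card_dvd[OF subP subN] subgroup_subset_normalizer[OF subP] cardP by (simp add: N_def)
    qed (simp add: not_dvd_imp_multiplicity_0)
  next
    case False
    then have qp: "q \<noteq> p" and dvd: "q dvd order G" by auto
    obtain Q where Q: "sylow_subgroup G q Q"
      using q finite_carrier by (rule sylow_subgroup_exists)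
    then have subQ: "subgroup Q G" and cardQ: "card Q = q ^ multiplicity q (order G)"
      by (auto simp: sylow_subgroup_def)
    interpret Q: subgroup Q G by (rule subQ)
    interpret QG: group "G\<lparr>carrier := Q\<rparr>" by (rule subgroup_imp_group[OF subQ])
    have "order G \<noteq> 0" using finite_carrier order_gt_0_iff_finite by simp
    then have "multiplicity q (order G) > 0"
      using q dvd by (simp add: prime_multiplicity_gt_zero_iff)
    then have "q dvd card Q" using cardQ by simp
    then have Q1: "Q \<noteq> {\<one>}" using prime_gt_1_nat[OF q] by auto
    \<comment> \<open>The order of V y divides both a power of q and a power of p.\<close>
    have QK: "y \<in> K" if y: "y \<in> Q" for y
    proof -
      have yG: "y \<in> carrier G" using y by simp
      have "y [^] card Q = \<one>"
        using QG.pow_order_eq_1[of y] y by (simp add: order_def flip: nat_pow_consistent)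
      then have "V y [^]\<^bsub>B\<^esub> card Q = \<one>\<^bsub>B\<^esub>"
        using V.hom_nat_pow[OF yG, of "card Q"] by simp
      then have "V.H.ord (V y) dvd q ^ multiplicity q (order G)"
        using yG cardQ V.H.pow_eq_id by simp
      moreover have "V.H.ord (V y) dvd p ^ j" using yG V.H.ord_dvd_group_order j by simp
      moreover have "coprime (q ^ multiplicity q (order G)) (p ^ j)"
        using q prime_p qp by (simp add: primes_coprime)
      ultimately have "V.H.ord (V y) = 1"
        using coprime_common_divisor_nat by blast
      then have "V y = \<one>\<^bsub>B\<^esub>" using yG V.H.ord_eq_1 by simp
      then show ?thesis using yG by (simp add: K_def kernel_def)
    qed
    define L where "L = normalizer G Q"
    have subL: "subgroup L G" unfolding L_def using Q.subset by (rule normalizer_imp_subgroup)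
    interpret L: group "G\<lparr>carrier := L\<rparr>" by (rule subgroup_imp_group[OF subL])
    have finL: "finite (carrier (G\<lparr>carrier := L\<rparr>))" using finite_subgroup[OF subL] by simp
    \<comment> \<open>Frattini argument: Q and g Q g^-1 are Sylow in K, so some k in K moves the
      second back to the first. Then k g normalizes Q and has the same image as g.\<close>
    have frattini: "\<exists>l\<in>L. V l = V g" if g: "g \<in> carrier G" for g
    proof -
      define R where "R = (\<lambda>h. g \<otimes> h \<otimes> inv g) ` Q"
      have "R \<subseteq> K" using QK normal_invE(2)[OF normK g] by (auto simp: R_def)
      then have "sylow_subgroup (G\<lparr>carrier := K\<rparr>) q R"
        using conjugate_sylow_subgroup[OF Q g] subK
        by (intro sylow_subgroup_within q finite_carrier) (simp_all add: R_def)
      moreover have "sylow_subgroup (G\<lparr>carrier := K\<rparr>) q Q"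
        using Q subK QK by (intro sylow_subgroup_within q finite_carrier) auto
      ultimately obtain k where "k \<in> carrier (G\<lparr>carrier := K\<rparr>)"
        and k: "(\<lambda>h. k \<otimes> h \<otimes> inv\<^bsub>G\<lparr>carrier := K\<rparr>\<^esub> k) ` R = Q"
        by (rule K.sylow_subgroups_conjugate[OF q finK]) simp
      then have kK: "k \<in> K" by simp
      then have kG: "k \<in> carrier G" and Vk: "V k = \<one>\<^bsub>B\<^esub>" by (auto simp: K_def kernel_def)
      have "k \<otimes> g \<in> L"
        unfolding L_def
      proof (rule normalizerI)
        fix h assume h: "h \<in> Q"
        have "k \<otimes> (g \<otimes> h \<otimes> inv g) \<otimes> inv k \<in> Q"
          using k kK h subK by (auto simp: R_def)
        then show "k \<otimes> g \<otimes> h \<otimes> inv (k \<otimes> g) \<in> Q"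
          using kG g h by (simp add: m_assoc inv_mult_group)
      qed (use finite_subgroup[OF subQ] Q.subset kG g in auto)
      moreover have "V (k \<otimes> g) = V g" using kG g Vk by simp
      ultimately show ?thesis by blast
    qed
    interpret VL: group_hom "G\<lparr>carrier := L\<rparr>" B V by (rule V.induced_group_hom'[OF subL])
    have "V ` L = V ` carrier G"
    proof (rule equalityI)
      show "V ` L \<subseteq> V ` carrier G" by (rule image_mono[OF subgroup.subset[OF subL]])
      show "V ` carrier G \<subseteq> V ` L"
      proof (rule image_subsetI)
        fix g assume "g \<in> carrier G"
        then obtain l where "l \<in> L" "V l = V g" using frattini by blast
        then show "V g \<in> V ` L" by (metis imageI)
      qed
    qed
    then have imgL: "card (V ` carrier G) dvd card L"
      using VL.card_image_dvd_order by (simp add: order_def)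
    \<comment> \<open>The order of K is prime to p, so the full p-part of the order of G sits in the
      image of V. This is also the image of L, so the p-part divides the order of L.\<close>
    have "p ^ multiplicity p (order G) dvd card (V ` carrier G) * card K"
      using V.card_image_kernel multiplicity_dvd[of p "order G"] by (simp add: K_def)
    moreover have "coprime (p ^ multiplicity p (order G)) (card K)"
      using prime_p ndvd by (simp add: prime_imp_coprime)
    ultimately have pow_dvd_L: "p ^ multiplicity p (order G) dvd card L"
      using imgL coprime_dvd_mult_left_iff dvd_trans by blast
    have dvd_L: "card L dvd order G" using subL by (rule subgroup_card_dvd_order)
    have "p dvd p ^ multiplicity p (order G)"
      using sylow_proper_nontrivial(3)[OF P] cardP by simp
    then have pL: "p dvd card L" using pow_dvd_L by (rule dvd_trans)
    have multL: "multiplicity p (card L) = multiplicity p (order G)"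
    proof (rule antisym)
      show "multiplicity p (card L) \<le> multiplicity p (order G)"
        using dvd_L \<open>order G \<noteq> 0\<close> by (intro dvd_imp_multiplicity_le)
      have "card L \<noteq> 0" using subgroup.finite_imp_card_positive[OF subL finite_carrier] by simp
      then show "multiplicity p (order G) \<le> multiplicity p (card L)"
        using pow_dvd_L prime_gt_1_nat[OF prime_p] by (intro multiplicity_geI) simp_all
    qed
    have nilL: "nilpotent_group (G\<lparr>carrier := L\<rparr>)"
      unfolding L_def
      using normalizer_prime_power_proper[OF q subQ cardQ Q1] pL subL
      by (intro nilpotent_if_proper) (simp_all add: L_def)
    obtain S where S: "sylow_subgroup (G\<lparr>carrier := L\<rparr>) p S"
      using prime_p finL by (rule L.sylow_subgroup_exists)
    have normS: "S \<lhd> G\<lparr>carrier := L\<rparr>"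
      using nilL prime_p finL S by (rule L.nilpotent_sylow_normal)
    have "sylow_subgroup G p S"
      using S incl_subgroup[OF subL] multL by (auto simp: sylow_subgroup_def order_def)
    then obtain g where g: "g \<in> carrier G" "(\<lambda>h. g \<otimes> h \<otimes> inv g) ` S = P"
      using sylow_subgroups_conjugate[OF prime_p finite_carrier _ P] by blast
    \<comment> \<open>Q lies in L and so normalizes S, which is normal in L. Conjugating by g
      carries S to P and Q into the normalizer of P.\<close>
    have "(\<lambda>h. g \<otimes> h \<otimes> inv g) ` Q \<subseteq> N"
    proof (rule image_subsetI)
      fix y assume y: "y \<in> Q"
      then have yL: "y \<in> L" using subgroup_subset_normalizer[OF subQ] by (auto simp: L_def)
      show "g \<otimes> y \<otimes> inv g \<in> N"
        unfolding N_def
      proof (rule normalizerI)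
        fix x assume "x \<in> P"
        then obtain s where s: "s \<in> S" "x = g \<otimes> s \<otimes> inv g" using g(2) by blast
        have sG: "s \<in> carrier G"
          using s(1) subgroup.subset[OF normal_imp_subgroup[OF normS]] subgroup.subset[OF subL] by auto
        have cancel: "inv g \<otimes> (g \<otimes> z) = z" if "z \<in> carrier G" for z
          using g(1) that by (simp flip: m_assoc)
        have "y \<otimes> s \<otimes> inv y \<in> S"
          using L.normal_invE(2)[OF normS, of y s] yL s(1) subL by simp
        then have "g \<otimes> (y \<otimes> s \<otimes> inv y) \<otimes> inv g \<in> P" using g(2) by blast
        then show "g \<otimes> y \<otimes> inv g \<otimes> x \<otimes> inv (g \<otimes> y \<otimes> inv g) \<in> P"
          using g(1) y sG by (simp add: s(2) m_assoc inv_mult_group cancel)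
      qed (use finite_subgroup[OF subP] P.subset g(1) y in auto)
    qed
    then have "card ((\<lambda>h. g \<otimes> h \<otimes> inv g) ` Q) dvd card N"
      using conjugate_subgroup[OF subQ g(1)] subN by (intro subgroup_card_dvd)
    then show ?thesis using card_conjugate[OF Q.subset g(1)] cardQ by simp
  qed
  moreover have "card N \<noteq> 0"
    using subgroup.finite_imp_card_positive[OF subN finite_carrier] by simp
  moreover have "order G \<noteq> 0" using finite_carrier order_gt_0_iff_finite by simp
  ultimately have "order G dvd card N"
    by (intro multiplicity_le_imp_dvd) (auto intro!: multiplicity_geI dest: prime_gt_1_nat)
  then have "card (carrier G) \<le> card N" using \<open>card N \<noteq> 0\<close> by (simp add: order_def dvd_imp_le)
  then have "N = carrier G"
    using card_seteq[OF finite_carrier subgroup.subset[OF subN]] by simp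
  then show False
    using normalizer_prime_power_proper[OF prime_p subP cardP sylow_proper_nontrivial(1)[OF P]]
    by (simp add: N_def)
qed

end

text \<open>The induction on the order passes to quotients, so it needs them in one fixed type.\<close>

lemma (in group) quotient_on_nat:
  assumes "finite (carrier G)" "N \<lhd> G"
  obtains Q :: "nat monoid" and h
  where "group_hom G Q h" "h ` carrier G = carrier Q" "kernel G Q h = N"
proof -
  define h where "h g = to_nat_on (rcosets N) (N #> g)" for g
  have "subgroup N G" using assms(2) by (rule normal_imp_subgroup)
  have countable: "countable (rcosets N)"
    using assms(1) by (auto simp: RCOSETS_def intro: countable_finite)
  \<comment> \<open>The fibres of h are the cosets of N, so the set of codes inherits the group
    structure of the quotient.\<close>
  have "weak_group_morphism h N G"
  proof (rule weak_group_morphismsI[OF assms(2)])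
    fix a b assume ab: "a \<in> carrier G" "b \<in> carrier G"
    then have "h a = h b \<longleftrightarrow> N #> a = N #> b"
      unfolding h_def using subgroup.subset[OF \<open>subgroup N G\<close>] countable
      by (intro to_nat_on_inj) (auto intro: rcosetsI)
    also have "\<dots> \<longleftrightarrow> a \<otimes> inv b \<in> N"
      using ab \<open>subgroup N G\<close>
      by (metis group_axioms rcos_self repr_independence subgroup.rcos_module)
    finally show "h a = h b \<longleftrightarrow> a \<otimes> inv b \<in> N" .
  qed
  then show thesis
    using that[OF weak_group_morphism_group_hom _ weak_group_morphism_ker] by (simp add: image_group_carrier)
qed

section \<open>Quotients and the induction on the order\<close>

lemma (in group_hom) vimage_subgroup:
  assumes "subgroup K H"
  shows "subgroup {g \<in> carrier G. h g \<in> K} G"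
  using subgroupE(3,4)[OF assms] subgroup.one_closed[OF assms]
  by (intro G.subgroupI) (auto simp: hom_one intro!: exI[of _ \<one>])

text \<open>The preimage of K has order |K| times the order of the kernel. Either factor can supply
  p: the kernel for an arbitrary q, or K itself when q = p.\<close>

lemma (in group_hom) p_proper_nilpotent_image:
  assumes surj: "h ` carrier G = carrier H"
    and nil: "p_proper_nilpotent p G" and p: "p dvd card (kernel G H h) \<or> q = p"
  shows "p_proper_nilpotent q H"
  unfolding p_proper_nilpotent_def
proof (intro allI impI, elim conjE)
  fix K assume K: "subgroup K H" "K \<noteq> carrier H" "q dvd card K"
  define L where "L = {g \<in> carrier G. h g \<in> K}"
  have L: "subgroup L G" unfolding L_def using K(1) by (rule vimage_subgroup)
  have hL: "h ` L = K"
    using surj subgroup.subset[OF K(1)] by (auto simp: L_def)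
  interpret L: group_hom "G\<lparr>carrier := L\<rparr>" H h by (rule induced_group_hom'[OF L])
  have "kernel (G\<lparr>carrier := L\<rparr>) H h = kernel G H h"
    using subgroup.one_closed[OF K(1)] by (auto simp: kernel_def L_def)
  then have "card L = card K * card (kernel G H h)"
    using L.card_image_kernel hL by (simp add: order_def)
  then have "p dvd card L" using p K(3) by auto
  moreover have "L \<noteq> carrier G" using hL surj K(2) by auto
  ultimately have nilL: "nilpotent_group (G\<lparr>carrier := L\<rparr>)"
    using nil L by (simp add: p_proper_nilpotent_def)
  have "h \<in> hom (G\<lparr>carrier := L\<rparr>) (H\<lparr>carrier := K\<rparr>)"
    using L.homh hL by (auto simp: hom_def)
  then interpret R: group_hom "G\<lparr>carrier := L\<rparr>" "H\<lparr>carrier := K\<rparr>" h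
    using L.G.group_axioms H.subgroup_imp_group[OF K(1)] by (simp add: group_hom_def group_hom_axioms_def)
  show "nilpotent_group (H\<lparr>carrier := K\<rparr>)"
    using nilL by (rule R.nilpotent_image[rotated]) (simp add: hL)
qed

lemma (in group_hom) solvable_if_kernel_image_solvable:
  assumes "solvable (G\<lparr>carrier := kernel G H h\<rparr>)" "solvable H" "h ` carrier G = carrier H"
  shows "solvable G"
proof (rule solvable_condition[OF _ group_hom_axioms assms(3) _ assms(1,2)])
  have "group_hom G G (\<lambda>x. x)"
    by (simp add: group_hom_def group_hom_axioms_def hom_def G.group_axioms)
  then show "group_hom (G\<lparr>carrier := kernel G H h\<rparr>) G (\<lambda>x. x)"
    using subgroup_kernel by (rule group_hom.induced_group_hom')
qed simp

lemma solvable_if_p_proper_nilpotent_nat: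
  fixes G :: "nat monoid"
  assumes "group G" "finite (carrier G)" "Factorial_Ring.prime p" "p dvd order G" "p_proper_nilpotent p G"
  shows "solvable G"
  using assms
\<comment> \<open>p varies along with G because the quotient may have to be treated with another
  prime.\<close>
proof (induction "order G" arbitrary: G p rule: less_induct)
  case less
  interpret group G by (rule less.prems(1))
  show ?case
  proof (rule ccontr)
    assume nonsolvable: "\<not> solvable G"
    have "critical_group G p"
    proof
      fix N assume N: "N \<lhd> G" "solvable (G\<lparr>carrier := N\<rparr>)"
      show "N = {\<one>\<^bsub>G\<^esub>}"
      proof (rule ccontr)
        assume "N \<noteq> {\<one>\<^bsub>G\<^esub>}"
        obtain Q :: "nat monoid" and h
          where h: "group_hom G Q h" "h ` carrier G = carrier Q" "kernel G Q h = N"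
          using less.prems(2) N(1) by (rule quotient_on_nat)
        interpret h: group_hom G Q h by (rule h(1))
        have card: "order Q * card N = order G"
          using h.card_image_kernel h(2,3) by (simp add: order_def)
        have "\<one>\<^bsub>G\<^esub> \<in> N" using subgroup.one_closed[OF normal_imp_subgroup[OF N(1)]] .
        have "finite N" using finite_subset[OF subgroup.subset[OF normal_imp_subgroup[OF N(1)]] less.prems(2)] .
        then have "1 < card N"
          using card_mono[of N "{\<one>\<^bsub>G\<^esub>}"] card_subset_eq[of N "{\<one>\<^bsub>G\<^esub>}"] \<open>\<one>\<^bsub>G\<^esub> \<in> N\<close> \<open>N \<noteq> {\<one>\<^bsub>G\<^esub>}\<close> by fastforce
        moreover have "order Q > 0"
          using h(2) less.prems(2) h.H.order_gt_0_iff_finite by (metis finite_imageI)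
        ultimately have less_order: "order Q < order G"
          using card by (metis mult.right_neutral mult_less_cancel1)
        have fin: "finite (carrier Q)" using h(2) less.prems(2) by (metis finite_imageI)
        have image: "p_proper_nilpotent q Q" if "p dvd card N \<or> q = p" for q
          using h.p_proper_nilpotent_image[OF h(2) less.prems(5)] that h(3) by simp
        have "solvable Q"
        \<comment> \<open>The trivial quotient is separated since no prime divides its
          order.\<close>
        proof (cases "order Q = 1")
          case True
          then have "carrier Q = {\<one>\<^bsub>Q\<^esub>}" using h.H.order_one_triv_iff by simp
          then show ?thesis using solvable_seq.unity[of Q] by (simp add: solvable_def)
        next
          case False
          have "\<exists>q. Factorial_Ring.prime q \<and> q dvd order Q \<and> (p dvd card N \<or> q = p)"
          proof (cases "p dvd order Q")
            case True
            then show ?thesis using less.prems(3) by blast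
          next
            case ndvd: False
            then have "p dvd card N"
              using less.prems(3,4) card by (metis prime_dvd_mult_iff)
            then show ?thesis using prime_factor_nat[OF False] by blast
          qed
          then show ?thesis
            using less.hyps[OF less_order h.H.group_axioms fin] image by blast
        qed
        then have "solvable G"
          using h.solvable_if_kernel_image_solvable h(2,3) N(2) by simp
        then show False using nonsolvable by contradiction
      qed
    qed (use less.prems in simp_all)
    then show False by (rule critical_group.contradiction)
  qed
qed

text \<open>The quotient by the trivial subgroup is a copy of G on natural numbers, to which the
  induction applies.\<close>

lemma (in group) solvable_if_p_proper_nilpotent:
  assumes "finite (carrier G)" "Factorial_Ring.prime p" "p dvd order G" "p_proper_nilpotent p G"
  shows "solvable G"
proof -
  obtain Q :: "nat monoid" and h
    where h: "group_hom G Q h" "h ` carrier G = carrier Q" "kernel G Q h = {\<one>}"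
    using assms(1) one_is_normal by (rule quotient_on_nat)
  interpret h: group_hom G Q h by (rule h(1))
  have "order Q = order G" using h.card_image_kernel h(2,3) by (simp add: order_def)
  moreover have "p_proper_nilpotent p Q"
    using h.p_proper_nilpotent_image[OF h(2) assms(4)] by simp
  moreover have "finite (carrier Q)" using h(2) assms(1) by (metis finite_imageI)
  ultimately have "solvable Q"
    using assms(2,3) h.H.group_axioms by (intro solvable_if_p_proper_nilpotent_nat) simp_all
  then show ?thesis using h.trivial_ker_imp_inj[OF h(3)] by (rule h.inj_hom_imp_solvable[rotated])
qed

section \<open>Maximal subgroups and the final theorem\<close>

lemma (in group) subset_maximal_subgroup:
  assumes "finite (carrier G)" "subgroup K G" "K \<noteq> carrier G"
  obtains H where "maximal_subgroup H G" "K \<subseteq> H"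
proof -
  let ?A = "{H. subgroup H G \<and> H \<noteq> carrier G}"
  have "finite ?A"
    using assms(1) subgroup.subset by (intro finite_subset[of ?A "Pow (carrier G)"]) auto
  moreover have "K \<in> ?A" using assms(2,3) by simp
  ultimately obtain H where H: "H \<in> ?A" "K \<subseteq> H" "\<And>L. L \<in> ?A \<Longrightarrow> H \<subseteq> L \<Longrightarrow> H = L"
    using finite_has_maximal2[of ?A K] by auto
  have "maximal_subgroup H G"
    unfolding maximal_subgroup_def using H(1,3) by blast
  then show thesis using H(2) by (rule that)
qed

theorem theorem1p1:
  fixes G (structure) and p :: nat
  assumes "group G" and "finite (carrier G)" and "\<not> solvable G"
    and "Factorial_Ring.prime p" and "p dvd order G"
  shows "\<exists>H. maximal_subgroup H G \<and> \<not> nilpotent_group (G\<lparr>carrier := H\<rparr>) \<and> p dvd card H"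
proof (rule ccontr)
  assume none: "\<not> ?thesis"
  interpret group G by (rule assms(1))
  have "p_proper_nilpotent p G"
    unfolding p_proper_nilpotent_def
  proof (intro allI impI, elim conjE)
    fix K assume K: "subgroup K G" "K \<noteq> carrier G" "p dvd card K"
    obtain H where H: "maximal_subgroup H G" "K \<subseteq> H"
      using assms(2) K(1,2) by (rule subset_maximal_subgroup)
    have subH: "subgroup H G" using H(1) by (simp add: maximal_subgroup_def)
    have "p dvd card H" using K(3) subgroup_card_dvd[OF K(1) subH H(2)] by (rule dvd_trans)
    then have "nilpotent_group (G\<lparr>carrier := H\<rparr>)" using none H(1) by blast
    then have "nilpotent_group (G\<lparr>carrier := H\<rparr>\<lparr>carrier := K\<rparr>)"
      by (rule group.nilpotent_subgroup[OF subgroup_imp_group[OF subH] _ subgroup_incl[OF K(1) subH H(2)]])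
    then show "nilpotent_group (G\<lparr>carrier := K\<rparr>)" by simp
  qed
  then have "solvable G" using assms(2,4,5) by (intro solvable_if_p_proper_nilpotent)
  then show False using assms(3) by contradiction
qed

end
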